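(* Every cube tiling of $\mathbb{R}^{6}$ contains a column. That is, if $T\subseteq\mathbb{R}^6$ is such that the cubes $[0,1)^6+t$, $t\in T$, are pairwise disjoint (for distinct $t\in T$) and their union is $\mathbb{R}^6$, then there exist $s\in\mathbb{R}^6$ and $i\in\{1,\ldots,6\}$ such that $s+ke_i\in T$ for every $k\in\mathbb{Z}$, where $e_i$ is the $i$-th element of the standard basis of $\mathbb{R}^6$.
   Context: For $T\subseteq\mathbb{R}^n$, the family $[0,1)^n+T=\{[0,1)^n+t\colon t\in T\}$ is a cube tiling of $\mathbb{R}^n$ if for each pair of distinct $s,t\in T$ the cubes $[0,1)^n+s$ and $[0,1)^n+t$ are disjoint and $\bigcup_{t\in T}([0,1)^n+t)=\mathbb{R}^n$. No periodicity or lattice assumption is made on $T$. A column is a family of cubes of the form $\{[0,1)^n+(s+ke_i)\colon k\in\mathbb{Z}\}$, where $s\in\mathbb{R}^n$ and $e_i$ is an element of the standard basis of $\mathbb{R}^n$; a tiling contains a column if all the cubes of some column belong to the tiling. *)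

theory Defs
  imports "HOL-Analysis.Analysis"
begin

definition unit_cube :: "(real ^ 'n) set" where
  "unit_cube = {x. \<forall>i. 0 \<le> x $ i \<and> x $ i < 1}"

definition cube :: "real ^ 'n \<Rightarrow> (real ^ 'n) set" where
  "cube t = (\<lambda>x. x + t) ` unit_cube"

definition cube_tiling :: "(real ^ 'n) set \<Rightarrow> bool" where
  "cube_tiling T \<longleftrightarrow>
     (\<forall>s\<in>T. \<forall>t\<in>T. s \<noteq> t \<longrightarrow> cube s \<inter> cube t = {}) \<and> (\<Union>t\<in>T. cube t) = UNIV"

definition column :: "real ^ 'n \<Rightarrow> 'n \<Rightarrow> (real ^ 'n) set set" where
  "column s i = {cube (s + of_int k *\<^sub>R axis i 1) | k :: int. True}"

definition contains_column :: "(real ^ 'n) set \<Rightarrow> bool" where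
  "contains_column T \<longleftrightarrow> (\<exists>s i. column s i \<subseteq> cube ` T)"

lemma mem_cube_iff: "x \<in> cube t \<longleftrightarrow> (\<forall>i. t $ i \<le> x $ i \<and> x $ i < t $ i + 1)"
proof
  assume "x \<in> cube t"
  then show "\<forall>i. t $ i \<le> x $ i \<and> x $ i < t $ i + 1"
    by (auto simp: cube_def unit_cube_def)
next
  assume *: "\<forall>i. t $ i \<le> x $ i \<and> x $ i < t $ i + 1"
  have "x - t \<in> unit_cube"
    using * by (auto simp: unit_cube_def) (metis add.commute diff_less_eq)
  then show "x \<in> cube t"
    unfolding cube_def by (metis diff_add_cancel image_eqI)
qed

lemma inj_cube: "inj (cube :: real ^ 'n \<Rightarrow> (real ^ 'n) set)"
proof (rule injI)
  fix s t :: "real ^ 'n"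
  assume eq: "cube s = cube t"
  have "s \<in> cube s" "t \<in> cube t" by (simp_all add: mem_cube_iff)
  then have "s \<in> cube t" "t \<in> cube s" using eq by auto
  then show "s = t"
    unfolding mem_cube_iff vec_eq_iff by (meson order.antisym)
qed

lemma contains_column_iff:
  "contains_column T \<longleftrightarrow> (\<exists>s i. \<forall>k :: int. s + of_int k *\<^sub>R axis i 1 \<in> T)"
proof -
  have "column s i \<subseteq> cube ` T \<longleftrightarrow> (\<forall>k :: int. s + of_int k *\<^sub>R axis i 1 \<in> T)" for s i
    unfolding column_def using inj_image_mem_iff[OF inj_cube] by blast
  then show ?thesis
    by (simp add: contains_column_def)
qed

end

theory Submission
  imports Defs
begin

text \<open>
  Split every coordinate of a translation vector t into its fractional part, the letter, and its
  integer part, the layer. A point x of the space lies in the cube at t iff in every coordinate i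
  the layer of t is the largest integer k with letter + k at most x i. So x matters only through
  the assignment of a layer to each coordinate and each letter. For a cube tiling every
  assignment z, even one that comes from no point x, meets exactly one cube
  (\<open>tiling_fits\<close>). This turns the tiling into a function L that sends z to the
  letters of the cube met by z, with one property: L z does not change when z is changed at letters
  that L z does not use. A column is a coordinate i and a z such that changing the layer of the
  letter L z i never changes L z. Hence the geometry is gone, and the claim is that no function L
  without columns (the locale \<open>lettering\<close>) exists on at most six coordinates.

  Write an arrow from a to b at z if some change of the layer of the letter L z a changes the letter
  in coordinate b. Without columns every coordinate has an outgoing arrow, and arrows are
  antisymmetric (\<open>arrow_asym\<close>). A brick is a cube with prescribed letters and layers,
  whether or not it belongs to the tiling; it is cut at z in those coordinates where L z has another
  letter. An arrow that starts in a cut coordinate ends in a coordinate where the brick can be cut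
  (\<open>cut_arrow\<close>). So if a brick is not a cube of the tiling, every cut coordinate has an
  arrow, and it leads to another one in which the brick can be cut. By antisymmetry at least three
  coordinates are involved (\<open>rigid_2\<close>), and everything below compares the oriented
  graphs formed by these arrows at neighbouring points.

  By induction on the number of coordinates, every slice in one coordinate t contains a column, which
  means that some coordinate a has an arrow to t and to nothing else (\<open>slice_lone_out\<close>).
  Such a lone arrow produces a brick that is cut, but never in a or t
  (\<open>lone_out_cut_brick\<close>). With at most five coordinates this leaves too little room.
  With six coordinates there are two cases.

  First, suppose that no brick is cut in at most three coordinates only. The brick from the lone
  arrow is then cut in subsets of a set of four coordinates, at some points in exactly three of them,
  and the arrows between these three form a cycle. A change in the fourth coordinate reverses the
  cycle without changing the letters. The two orientations together determine so many cubes that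
  the fourth coordinate is the direction of a column (\<open>double_cycle\<close>).

  Second, suppose that some brick is cut in exactly three coordinates a, b, c. Then the
  three-dimensional section through it is known completely (\<open>corner\<close>): in each of
  the three coordinates there are one main letter and one exceptional letter, arranged like the three
  rods around the corner of a cube. Each rod again gives a brick that is cut, now only in the other
  three coordinates x, y, z, and these have rods too. In this way one gets three bricks, cut only in
  a, b, c, that share their letters there and differ in x, y, z. Comparing their rods shows that
  their main letters and the extent of their rods in the coordinate a agree
  (\<open>corner_main_subset\<close>). Then one point can be found that has to read the main
  letters of x, y, z and at the same time lies in a rod of the first brick, where the letters of
  x, y, z are the exceptional ones (\<open>no_cut_brick_3\<close>).
\<close>

section \<open>Letterings without columns\<close>

definition upd :: "('i \<Rightarrow> 'a \<Rightarrow> 'b) \<Rightarrow> 'i \<Rightarrow> 'a \<Rightarrow> 'b \<Rightarrow> 'i \<Rightarrow> 'a \<Rightarrow> 'b" where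
  "upd z i l k = z(i := (z i)(l := k))"

lemma upd_simps [simp]:
  "upd z i l k i l = k"
  "m \<noteq> l \<Longrightarrow> upd z i l k i m = z i m"
  "j \<noteq> i \<Longrightarrow> upd z i l k j = z j"
  by (simp_all add: upd_def)

lemma upd_commute: "i \<noteq> j \<Longrightarrow> upd (upd z i l k) j m n = upd (upd z j m n) i l k"
  by (auto simp: upd_def fun_eq_iff)

lemma upd_eq: "upd z i l k j m = (if j = i \<and> m = l then k else z j m)"
  by (simp add: upd_def)

lemma card_ge_2D: "2 \<le> card S \<Longrightarrow> \<exists>x\<in>S. \<exists>y\<in>S. x \<noteq> y"
  using obtain_subset_with_card_n[of 2 S] by (metis card_2_iff insert_subset)

text \<open>
  L z i is the letter in coordinate i of the cube that z meets. The default value outside A makes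
  equality on A the same as equality of functions, and it makes slices in fewer coordinates
  instances of the same locale.
\<close>

locale lettering =
  fixes A :: "'i set" and L :: "('i \<Rightarrow> 'a \<Rightarrow> 'b) \<Rightarrow> 'i \<Rightarrow> 'a"
  assumes finite_A: "finite A"
    and determined: "\<And>z z'. (\<And>i. i \<in> A \<Longrightarrow> z' i (L z i) = z i (L z i)) \<Longrightarrow> L z' = L z"
    and outside: "\<And>z i. i \<notin> A \<Longrightarrow> L z i = undefined"
    and no_column: "\<And>z i. i \<in> A \<Longrightarrow> \<exists>k. L (upd z i (L z i) k) \<noteq> L z"
begin

lemma upd_unread: "l \<noteq> L z i \<Longrightarrow> L (upd z i l k) = L z"
  by (rule determined) (auto simp: upd_eq)

text \<open>
  Along a line in direction i the letter in coordinate i is constant, because the cubes met by a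
  line have to tile it without overlap.
\<close>

lemma letter_on_line: assumes "\<And>j. j \<noteq> i \<Longrightarrow> z' j = z j" shows "L z' i = L z i"
proof (rule ccontr)
  assume ne: "L z' i \<noteq> L z i"
  let ?p = "upd z i (L z' i) (z' i (L z' i))"
  have "L ?p = L z" using ne by (rule upd_unread)
  moreover have "L ?p = L z'" by (rule determined) (use assms ne in \<open>auto simp: upd_eq\<close>)
  ultimately show False using ne by simp
qed

lemma letter_upd [simp]: "L (upd z i l k) i = L z i"
  by (rule letter_on_line) simp

text \<open>
  A change of the coordinate a can change the letter in b only if it hits the letter that is read
  in a, so this relation describes all changes along the line in direction a.
\<close>

definition arrow :: "('i \<Rightarrow> 'a \<Rightarrow> 'b) \<Rightarrow> 'i \<Rightarrow> 'i \<Rightarrow> bool" where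
  "arrow z a b \<longleftrightarrow> (\<exists>k. L (upd z a (L z a) k) b \<noteq> L z b)"

lemma arrowI: assumes "\<And>j. j \<noteq> a \<Longrightarrow> z' j = z j" and "L z' b \<noteq> L z b" shows "arrow z a b"
proof -
  have "L (upd z a (L z a) (z' a (L z a))) = L z'"
    by (rule determined) (use assms(1) letter_on_line[of a z' z] in \<open>auto simp: upd_eq\<close>)
  then show ?thesis using assms(2) unfolding arrow_def by metis
qed

lemma not_arrow: "\<not> arrow z a b \<Longrightarrow> (\<And>j. j \<noteq> a \<Longrightarrow> z' j = z j) \<Longrightarrow> L z' b = L z b"
  using arrowI by blast

lemma arrow_ne: "arrow z a b \<Longrightarrow> a \<noteq> b" by (auto simp: arrow_def)

lemma arrow_in: "arrow z a b \<Longrightarrow> b \<in> A" unfolding arrow_def using outside by metis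

lemma arrow_ex: "a \<in> A \<Longrightarrow> \<exists>b. arrow z a b"
  using no_column[of a z] unfolding arrow_def by (metis ext)

text \<open>
  If moves in a and in b could each change the letter of the other coordinate, then both moves
  together would meet the same cube as either of them alone, since the letter that was moved is no
  longer read. But the first move keeps the letter of a and the second does not.
\<close>

lemma arrow_asym: assumes "arrow z a b" shows "\<not> arrow z b a"
proof
  assume "arrow z b a"
  then obtain k l where k: "L (upd z a (L z a) k) b \<noteq> L z b" and l: "L (upd z b (L z b) l) a \<noteq> L z a"
    using assms by (auto simp: arrow_def)
  have ab: "a \<noteq> b" using assms arrow_ne by blast
  have 1: "L (upd (upd z a (L z a) k) b (L z b) l) = L (upd z a (L z a) k)"
    using k by (intro upd_unread) auto
  have 2: "L (upd (upd z b (L z b) l) a (L z a) k) = L (upd z b (L z b) l)"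
    using l by (intro upd_unread) auto
  have "L (upd z a (L z a) k) a = L (upd z b (L z b) l) a"
    using 1 2 upd_commute[OF ab] by metis
  then show False using l by simp
qed

lemma arrow_same: assumes "arrow z a b" and "\<And>j. j \<noteq> a \<Longrightarrow> z' j = z j" shows "arrow z' a b"
proof (rule ccontr)
  assume n: "\<not> arrow z' a b"
  obtain k where k: "L (upd z a (L z a) k) b \<noteq> L z b" using assms(1) by (auto simp: arrow_def)
  have "L (upd z a (L z a) k) b = L z' b" using n by (rule not_arrow) (simp add: assms(2))
  moreover have "L z b = L z' b" using n by (rule not_arrow) (simp add: assms(2))
  ultimately show False using k by simp
qed

text \<open>
  The points of the cube with letters lam and layers kap, which may or may not belong to the tiling.
\<close>

definition brick :: "('i \<Rightarrow> 'a) \<Rightarrow> ('i \<Rightarrow> 'b) \<Rightarrow> ('i \<Rightarrow> 'a \<Rightarrow> 'b) \<Rightarrow> bool" where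
  "brick lam kap z \<longleftrightarrow> (\<forall>i\<in>A. z i (lam i) = kap i)"

definition cut :: "('i \<Rightarrow> 'a) \<Rightarrow> ('i \<Rightarrow> 'a \<Rightarrow> 'b) \<Rightarrow> 'i set" where
  "cut lam z = {i \<in> A. L z i \<noteq> lam i}"

text \<open>
  A brick that is not a cube of the tiling, with S bounding the coordinates in which the cubes
  of the tiling that meet it differ from it.
\<close>

definition cut_brick :: "'i set \<Rightarrow> ('i \<Rightarrow> 'a) \<Rightarrow> ('i \<Rightarrow> 'b) \<Rightarrow> bool" where
  "cut_brick S lam kap \<longleftrightarrow> (\<forall>z. brick lam kap z \<longrightarrow> cut lam z \<subseteq> S \<and> cut lam z \<noteq> {})"

definition rigid :: "nat \<Rightarrow> bool" where
  "rigid s \<longleftrightarrow> (\<forall>S lam kap. finite S \<longrightarrow> card S \<le> s \<longrightarrow> \<not> cut_brick S lam kap)"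

lemma brick_const: "brick lam kap (\<lambda>i _. kap i)" by (simp add: brick_def)

lemma cut_brickD: "cut_brick S lam kap \<Longrightarrow> brick lam kap z \<Longrightarrow> cut lam z \<subseteq> S"
  "cut_brick S lam kap \<Longrightarrow> brick lam kap z \<Longrightarrow> cut lam z \<noteq> {}"
  by (auto simp: cut_brick_def)

lemma brick_upd: "brick lam kap z \<Longrightarrow> l \<noteq> lam i \<Longrightarrow> brick lam kap (upd z i l k)"
  by (auto simp: brick_def upd_eq)

lemma cut_memD: "i \<in> cut lam z \<Longrightarrow> L z i \<noteq> lam i" "i \<in> cut lam z \<Longrightarrow> i \<in> A"
  by (auto simp: cut_def)

lemma brick_step: "brick lam kap z \<Longrightarrow> i \<in> cut lam z \<Longrightarrow> brick lam kap (upd z i (L z i) k)"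
  by (auto intro: brick_upd simp: cut_def)

text \<open>
  If the cube met at one point of a brick is the brick itself, then it is met at all its points.
\<close>

lemma cut_empty_spread:
  assumes "brick lam kap z" "cut lam z = {}" "brick lam kap z'" shows "L z' = L z"
proof (rule determined)
  fix i assume "i \<in> A"
  then show "z' i (L z i) = z i (L z i)" using assms by (auto simp: brick_def cut_def)
qed

lemma cut_brickI:
  assumes "\<And>z. brick lam kap z \<Longrightarrow> cut lam z \<subseteq> S" and "brick lam kap z0" and "cut lam z0 \<noteq> {}"
  shows "cut_brick S lam kap"
  unfolding cut_brick_def
proof (intro allI impI conjI)
  fix z assume b: "brick lam kap z"
  show "cut lam z \<subseteq> S" using assms(1) b .
  show "cut lam z \<noteq> {}"
  proof
    assume e: "cut lam z = {}"
    then have "L z0 = L z" using cut_empty_spread b assms(2) by blast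
    then show False using e assms(3) by (simp add: cut_def)
  qed
qed

text \<open>
  The move behind the arrow stays in the brick, since it changes no layer of lam. So the target is
  cut before or after it.
\<close>

lemma cut_arrow:
  assumes "cut_brick S lam kap" "brick lam kap z" "a \<in> cut lam z" "arrow z a b" shows "b \<in> S"
proof -
  obtain k where k: "L (upd z a (L z a) k) b \<noteq> L z b" using assms(4) by (auto simp: arrow_def)
  have "b \<in> A" using assms(4) arrow_in by blast
  then have "b \<in> cut lam z \<or> b \<in> cut lam (upd z a (L z a) k)" using k by (auto simp: cut_def)
  then show ?thesis using assms(1) cut_brickD(1)[OF assms(1,2)] cut_brickD(1)[OF assms(1) brick_step[OF assms(2,3)]] by blast
qed

lemma cut_keep: "a \<in> cut lam z \<Longrightarrow> a \<in> cut lam (upd z a l k)"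
  by (auto simp: cut_def)

text \<open>
  A cut coordinate a has an arrow to some b, and b is cut at a point of the line in direction a.
  There b needs an arrow as well, and by antisymmetry it does not go back to a but to a third
  coordinate.
\<close>

lemma rigid_2: "rigid 2"
  unfolding rigid_def
proof (intro allI impI notI)
  fix S :: "'i set" and lam kap
  assume S: "finite S" "card S \<le> 2" and c: "cut_brick S lam kap"
  have two: "b = c" if "a \<in> S" "b \<in> S" "c \<in> S" "b \<noteq> a" "c \<noteq> a" for a b c
  proof (rule ccontr)
    assume "b \<noteq> c"
    then have "card {a,b,c} = 3" using that by auto
    moreover have "card {a,b,c} \<le> card S" using that S by (intro card_mono) auto
    ultimately show False using S by simp
  qed
  obtain z where z: "brick lam kap z" using brick_const by blast
  obtain a where a: "a \<in> cut lam z" using cut_brickD(2)[OF c z] by blast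
  obtain b where ab: "arrow z a b" using arrow_ex a by (auto simp: cut_def)
  then obtain k where k: "L (upd z a (L z a) k) b \<noteq> L z b" by (auto simp: arrow_def)
  have bA: "b \<in> A" using ab arrow_in by blast
  obtain p where p: "brick lam kap p" "a \<in> cut lam p" "b \<in> cut lam p" "arrow p a b"
  proof (cases "b \<in> cut lam z")
    case True then show ?thesis using that z a ab by blast
  next
    case False
    then have "b \<in> cut lam (upd z a (L z a) k)" using k bA by (auto simp: cut_def)
    moreover have "arrow (upd z a (L z a) k) a b" by (rule arrow_same[OF ab]) simp
    ultimately show ?thesis using that brick_step[OF z a] cut_keep[OF a] by blast
  qed
  obtain d where d: "arrow p b d" using arrow_ex p(3) by (auto simp: cut_def)
  have "a \<in> S" "b \<in> S" "d \<in> S" using p c d cut_arrow cut_brickD(1) by blast+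
  moreover have "b \<noteq> a" "d \<noteq> b" using arrow_ne ab d by blast+
  ultimately have "d = a" using two[of b d a] by blast
  then show False using d p(4) arrow_asym by blast
qed

text \<open>
  If r were the only cut coordinate at z, then the letter e read there would be read in coordinate r
  throughout the brick. So every brick obtained by replacing the letter of r by e, in any layer, is cut
  only in the other coordinates of S. These are too few, hence all these bricks are cubes of the
  tiling, and they form a column.
\<close>

lemma cut_ge_2:
  assumes r: "rigid s" and c: "cut_brick S lam kap" and S: "finite S" "card S \<le> Suc s" and z: "brick lam kap z"
  shows "2 \<le> card (cut lam z)"
proof (rule ccontr)
  assume "\<not> 2 \<le> card (cut lam z)"
  moreover have fin: "finite (cut lam z)" using finite_A by (simp add: cut_def)
  moreover have "cut lam z \<noteq> {}" using cut_brickD(2)[OF c z] .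
  ultimately have "card (cut lam z) = 1" by (metis One_nat_def Suc_1 card_0_eq less_2_cases not_le)
  then obtain r where r1: "cut lam z = {r}" by (auto simp: card_1_singleton_iff)
  have rA: "r \<in> A" and rS: "r \<in> S" and e: "L z r \<noteq> lam r" using r1 cut_brickD(1)[OF c z] by (auto simp: cut_def)
  have Li: "L z i = lam i" if "i \<in> A" "i \<noteq> r" for i using r1 that by (auto simp: cut_def)
  define e where "e = L z r"
  have ene: "e \<noteq> lam r" using \<open>L z r \<noteq> lam r\<close> by (simp add: e_def)
  have let_e: "L p r = e" if p: "brick lam kap p" for p
  proof -
    have "L (upd p r e (z r e)) = L z"
      by (rule determined) (use p z Li in \<open>auto simp: upd_eq e_def brick_def\<close>)
    then show ?thesis by (metis letter_upd e_def)
  qed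
  \<comment> \<open>the brick in direction r with letter e and layer x\<close>
  have col: "L (upd z r (L z r) x) = L z" for x
  proof -
    let ?lam = "lam(r := e)" and ?kap = "kap(r := x)"
    have sub: "cut ?lam p \<subseteq> S - {r}" if p: "brick ?lam ?kap p" for p
    proof
      fix i assume i: "i \<in> cut ?lam p"
      let ?q = "upd p r (lam r) (kap r)"
      have q: "brick lam kap ?q" using p ene by (auto simp: brick_def upd_eq split: if_splits)
      have "L ?q r = e" using let_e q .
      then have "L p r = e" by simp
      then have "L ?q = L p" by (intro upd_unread) (use ene in auto)
      moreover have "i \<noteq> r" using i \<open>L p r = e\<close> by (auto simp: cut_def)
      ultimately have "i \<in> cut lam ?q" using i by (auto simp: cut_def)
      then show "i \<in> S - {r}" using cut_brickD(1)[OF c q] \<open>i \<noteq> r\<close> by blast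
    qed
    have "card (S - {r}) \<le> s" using S rS by simp
    then have nb: "\<not> cut_brick (S - {r}) ?lam ?kap" using r S unfolding rigid_def by blast
    have bx: "brick ?lam ?kap (upd z r (L z r) x)" using z by (auto simp: brick_def upd_eq e_def)
    have "cut ?lam (upd z r (L z r) x) = {}" using cut_brickI[of ?lam ?kap "S - {r}"] sub bx nb by blast
    then have "L (upd z r (L z r) x) i = ?lam i" if "i \<in> A" for i using that by (auto simp: cut_def)
    then have "L (upd z r (L z r) x) i = L z i" if "i \<in> A" for i using that Li by (auto simp: e_def)
    then show ?thesis using outside by (metis ext)
  qed
  then show False using no_column[OF rA, of z] by simp
qed

lemma finite_cut [simp]: "finite (cut lam z)" using finite_A by (simp add: cut_def)

text \<open>
  The cube P at z and its neighbours in direction a have the same letters except in t. Replace P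
  by its neighbour brick in direction t, in a layer q where that is not a cube of the tiling. On this
  brick the letter in t is that of P, by \<open>letter_on_line\<close>. The letter in a is that
  of P too: otherwise the layer in a could be changed to one where the neighbour of P with another
  t-letter is met, which the letter in t excludes.
\<close>

lemma lone_out_cut_brick:
  assumes a: "a \<in> A" and lone: "\<And>b. arrow z a b \<Longrightarrow> b = t"
  obtains kap z1 where "cut_brick (A - {a,t}) (L z) kap" "brick (L z) kap z1" "\<And>r. r \<in> cut (L z) z1 \<Longrightarrow> arrow z t r"
proof -
  define lam where "lam = L z"
  have "arrow z a t" using arrow_ex[OF a] lone by metis
  then have ne: "a \<noteq> t" and t: "t \<in> A" using arrow_ne[of z a t] arrow_in[of z a t] by auto
  obtain k1 where "L (upd z a (lam a) k1) t \<noteq> lam t" using \<open>arrow z a t\<close> by (auto simp: arrow_def lam_def)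
  define w where "w = upd z a (lam a) k1"
  have wt: "L w t \<noteq> lam t" using \<open>L (upd z a (lam a) k1) t \<noteq> lam t\<close> by (simp add: w_def)
  have w: "L w i = lam i" if "i \<noteq> t" for i
    unfolding w_def lam_def by (rule not_arrow[of z a]) (use lone that in auto)
  obtain q where q: "L (upd z t (lam t) q) \<noteq> lam" using no_column[OF t, of z] by (auto simp: lam_def)
  define z1 where "z1 = upd z t (lam t) q"
  define kap where "kap = (\<lambda>i. z1 i (lam i))"
  have kap: "kap i = z i (lam i)" if "i \<noteq> t" for i using that by (simp add: kap_def z1_def)
  have kt: "kap t = q" by (simp add: kap_def z1_def)
  have b1: "brick lam kap z1" by (simp add: brick_def kap_def)
  have bk: "L (upd p t (lam t) (z t (lam t))) = lam" if "brick lam kap p" for p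
    unfolding lam_def by (rule determined) (use that in \<open>auto simp: brick_def upd_eq kap lam_def\<close>)
  have pt: "L p t = lam t" if "brick lam kap p" for p
    using bk[OF that] by (metis letter_upd)
  have pa: "L p a = lam a" if b: "brick lam kap p" for p
  proof (rule ccontr)
    assume na: "L p a \<noteq> lam a"
    define p1 where "p1 = upd p t (L w t) (z t (L w t))"
    have "L p1 = L p" unfolding p1_def using pt[OF b] wt by (intro upd_unread) auto
    moreover have "L (upd p1 a (lam a) k1) = L p1" by (rule upd_unread) (use na calculation in auto)
    moreover have "L (upd p1 a (lam a) k1) = L w"
    proof (rule determined)
      fix i assume "i \<in> A"
      then show "upd p1 a (lam a) k1 i (L w i) = w i (L w i)"
        using b ne kap w[of i] w[of a] by (cases "i = t") (auto simp: brick_def p1_def upd_eq w_def)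
    qed
    ultimately show False using wt pt[OF b] by simp
  qed
  have "cut lam p \<subseteq> A - {a,t}" if "brick lam kap p" for p using pt[OF that] pa[OF that] by (auto simp: cut_def)
  moreover have "cut lam z1 \<noteq> {}"
  proof
    assume "cut lam z1 = {}"
    then have "L z1 i = lam i" for i using outside by (cases "i \<in> A") (auto simp: cut_def lam_def)
    then show False using q by (auto simp: z1_def)
  qed
  ultimately have "cut_brick (A - {a,t}) lam kap" using cut_brickI b1 by blast
  moreover have "arrow z t r" if "r \<in> cut lam z1" for r
    by (rule arrowI[of t z1]) (use that in \<open>auto simp: cut_def z1_def lam_def\<close>)
  ultimately show ?thesis using that b1 lam_def by blast
qed

text \<open>
  The brick of \<open>lone_out_cut_brick\<close> is cut in at least two coordinates at the point
  next to z, and each of them is the target of an arrow from t.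
\<close>

lemma lone_out_fan:
  assumes r: "rigid s" and A: "card A \<le> s + 3" and a: "a \<in> A" and lone: "\<And>b. arrow z a b \<Longrightarrow> b = t"
  obtains b c where "arrow z t b" "arrow z t c" "b \<noteq> c"
proof -
  obtain kap z1 where c: "cut_brick (A - {a,t}) (L z) kap" and b: "brick (L z) kap z1"
    and o: "\<And>r. r \<in> cut (L z) z1 \<Longrightarrow> arrow z t r" using lone_out_cut_brick[OF a lone] by blast
  have "arrow z a t" using arrow_ex[OF a] lone by metis
  then have "a \<noteq> t" "t \<in> A" using arrow_ne[of z a t] arrow_in[of z a t] by auto
  then have "card (A - {a,t}) = card A - 2" using a finite_A by (subst card_Diff_subset) auto
  then have "2 \<le> card (cut (L z) z1)" using A finite_A by (intro cut_ge_2[OF r c _ _ b]) auto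
  then obtain x y where "x \<in> cut (L z) z1" "y \<in> cut (L z) z1" "x \<noteq> y"
    using card_ge_2D by blast
  then show ?thesis using that o by blast
qed

text \<open>
  Suppose that always exactly two coordinates x and y are cut. The arrow from x has to end in y: if
  a move in x starts to cut a third coordinate, then it has to stop cutting y. By symmetry there is an
  arrow from y to x, which contradicts antisymmetry.
\<close>

lemma three_cut_point:
  assumes c: "cut_brick J lam kap" and two: "\<And>p. brick lam kap p \<Longrightarrow> 2 \<le> card (cut lam p)"
  obtains p where "brick lam kap p" "3 \<le> card (cut lam p)"
proof (rule ccontr)
  assume nt: "\<not> thesis"
  have "card (cut lam p) < 3" if b: "brick lam kap p" for p
    using nt \<open>\<And>p. brick lam kap p \<Longrightarrow> 3 \<le> card (cut lam p) \<Longrightarrow> thesis\<close>[OF b] by linarith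
  then have eq2: "card (cut lam p) = 2" if "brick lam kap p" for p using two[OF that] that by fastforce
  obtain p where p: "brick lam kap p" using brick_const by blast
  obtain x y where xy: "cut lam p = {x,y}" "x \<noteq> y" using eq2[OF p] by (auto simp: card_2_iff)
  have *: "arrow p x y" if xy: "cut lam p = {x,y}" "x \<noteq> y" for x y
  proof (rule ccontr)
    assume n: "\<not> arrow p x y"
    have xA: "x \<in> cut lam p" using xy by blast
    then obtain b where b: "arrow p x b" using arrow_ex[OF cut_memD(2)[OF xA]] by blast
    then obtain k where k: "L (upd p x (L p x) k) b \<noteq> L p b" by (auto simp: arrow_def)
    let ?q = "upd p x (L p x) k"
    have "b \<noteq> x" "b \<noteq> y" "b \<in> A" using arrow_ne[OF b] b n arrow_in[OF b] by auto
    have "b \<notin> cut lam p" using xy(1) \<open>b \<noteq> x\<close> \<open>b \<noteq> y\<close> by simp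
    then have "b \<in> cut lam ?q" using k \<open>b \<in> A\<close> by (simp add: cut_def)
    have "x \<in> cut lam ?q" using xA by (rule cut_keep)
    have "L ?q y = L p y" using n by (rule not_arrow) simp
    moreover have "y \<in> cut lam p" using xy(1) by simp
    ultimately have "y \<in> cut lam ?q" by (simp add: cut_def)
    have "card {b,x,y} \<le> card (cut lam ?q)"
      using \<open>b \<in> cut lam ?q\<close> \<open>x \<in> cut lam ?q\<close> \<open>y \<in> cut lam ?q\<close> by (intro card_mono) auto
    then show False using eq2[OF brick_step[OF p xA]] \<open>b \<noteq> x\<close> \<open>b \<noteq> y\<close> xy by simp
  qed
  have "arrow p x y" "arrow p y x" using *[of x y] *[of y x] xy by (auto simp: insert_commute)
  then show False using arrow_asym[of p x y] by simp
qed

section \<open>Lone arrows with at most five coordinates\<close>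

lemma card_Diff_pair: "a \<in> A \<Longrightarrow> t \<in> A \<Longrightarrow> a \<noteq> t \<Longrightarrow> card (A - {a,t}) = card A - 2"
  using finite_A by (subst card_Diff_subset) auto

lemma lone_out_small:
  assumes "card A \<le> 4" and a: "a \<in> A" and lone: "\<And>b. arrow z a b \<Longrightarrow> b = t"
  shows False
proof -
  have "arrow z a t" using arrow_ex[OF a, of z] lone by metis
  then have ne: "a \<noteq> t" and t: "t \<in> A" using arrow_ne[of z a t] arrow_in[of z a t] by auto
  obtain kap where "cut_brick (A - {a,t}) (L z) kap" using lone_out_cut_brick[OF a lone] by blast
  moreover have "card (A - {a,t}) \<le> 2" using card_Diff_pair[OF a t ne] assms(1) by simp
  ultimately show False using rigid_2 finite_A unfolding rigid_def by blast
qed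

text \<open>
  The brick of the lone arrow can be cut in three coordinates only, and by
  \<open>three_cut_point\<close> it is cut in all three at some point p. Every coordinate that has
  only one arrow at p points to one with two arrows, by \<open>lone_out_fan\<close>. One of
  those two would have to go back. So all three coordinates have two arrows, against antisymmetry.
\<close>

lemma lone_out_5:
  assumes A5: "card A = 5" and a: "a \<in> A" and lone: "\<And>b. arrow z a b \<Longrightarrow> b = t"
  shows False
proof -
  have "arrow z a t" using arrow_ex[OF a, of z] lone by metis
  then have ne: "a \<noteq> t" and t: "t \<in> A" using arrow_ne[of z a t] arrow_in[of z a t] by auto
  define J where "J = A - {a,t}"
  have J3: "card J = 3" and fJ: "finite J" using card_Diff_pair[OF a t ne] A5 finite_A by (auto simp: J_def)
  obtain kap where c: "cut_brick J (L z) kap" using lone_out_cut_brick[OF a lone] J_def by metis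
  have two: "2 \<le> card (cut (L z) p)" if "brick (L z) kap p" for p
    by (rule cut_ge_2[OF rigid_2 c fJ _ that]) (simp add: J3)
  obtain p where p: "brick (L z) kap p" and p3: "3 \<le> card (cut (L z) p)"
    using three_cut_point[OF c two] by blast
  have cp: "cut (L z) p = J" using cut_brickD(1)[OF c p] p3 J3 fJ by (simp add: card_seteq)
  have ex: "\<exists>b. arrow p r b" if "r \<in> J" for r using that by (intro arrow_ex) (simp add: J_def)
  have inJ: "b \<in> J" if "r \<in> J" "arrow p r b" for r b using cut_arrow[OF c p _ that(2)] cp that(1) by simp
  obtain x y w where J: "J = {x,y,w}" "x \<noteq> y" "y \<noteq> w" "x \<noteq> w" using J3 by (auto simp: card_3_iff)
  have both: "arrow p r s" if rs: "r \<in> J" "s \<in> J" "r \<noteq> s" for r s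
  proof (rule ccontr)
    assume n: "\<not> arrow p r s"
    obtain u where u: "arrow p r u" using ex rs(1) by blast
    have "b = u" if "arrow p r b" for b
      using inJ[OF rs(1) that] inJ[OF rs(1) u] n u that arrow_ne[OF that] arrow_ne[OF u] J rs by auto
    then obtain b c where bc: "arrow p u b" "arrow p u c" "b \<noteq> c"
      using lone_out_fan[OF rigid_2, of r p u] rs(1) A5 J_def by auto
    have uJ: "u \<in> J" using inJ[OF rs(1) u] .
    have "b \<in> J" "c \<in> J" using inJ[OF uJ] bc by auto
    moreover have "b \<noteq> r" "c \<noteq> r" using arrow_asym[OF u] bc by auto
    moreover have "b \<noteq> u" "c \<noteq> u" using arrow_ne bc by auto
    ultimately show False using J uJ arrow_ne[OF u] bc(3) rs(1) by auto
  qed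
  show False using both[of x y] both[of y x] J arrow_asym[of p x y] by simp
qed

section \<open>Lone arrows with six coordinates when no brick is cut in only three\<close>

text \<open>
  The arrows at p would form an oriented graph on four vertices in which every vertex has an outgoing
  edge and every vertex with only one outgoing edge points to a vertex with at least two. No such graph
  exists: its at most six edges leave room for at most two vertices with several outgoing edges. If
  there are two, then all six pairs are joined, but the other two vertices point only to these and
  are not joined. If there is one, then all others point to it and it points nowhere.
\<close>

lemma full_cut_4:
  assumes r3: "rigid 3" and A6: "card A = 6" and c: "cut_brick J lam kap" and J4: "card J = 4"
    and p: "brick lam kap p" and full: "cut lam p = J"
  shows False
proof -
  have JA: "J \<subseteq> A" using full by (auto simp: cut_def)
  have ex: "\<exists>b. arrow p r b" if "r \<in> J" for r using that JA by (intro arrow_ex) auto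
  have inJ: "b \<in> J" if "r \<in> J" "arrow p r b" for r b using cut_arrow[OF c p _ that(2)] full that(1) by simp
  have fan: "arrow p u s" if u: "arrow p r u" and r: "r \<in> J" "s \<in> J" "s \<noteq> r" "s \<noteq> u" "\<not> arrow p r s"
    and lone: "\<And>v. v \<in> J \<Longrightarrow> v \<noteq> s \<Longrightarrow> v \<noteq> u \<Longrightarrow> \<not> arrow p r v" for r u s
  proof (rule ccontr)
    assume n: "\<not> arrow p u s"
    have only: "b = u" if "arrow p r b" for b using that lone inJ[OF r(1) that] r(5) by blast
    have "card A \<le> 3 + 3" "r \<in> A" using A6 JA r(1) by auto
    from lone_out_fan[OF r3 this only] obtain b c where bc: "arrow p u b" "arrow p u c" "b \<noteq> c" by blast
    have uJ: "u \<in> J" using inJ[OF r(1) u] .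
    have "{r,u,s,b,c} \<subseteq> J" using inJ[OF uJ] bc uJ r by auto
    moreover have "b \<noteq> r" "c \<noteq> r" using arrow_asym[OF u] bc by auto
    moreover have "b \<noteq> u" "c \<noteq> u" using arrow_ne bc by auto
    moreover have "b \<noteq> s" "c \<noteq> s" using n bc by auto
    ultimately have "card {r,u,s,b,c} = 5" using r arrow_ne[OF u] bc(3) by auto
    moreover have "finite J" using J4 card.infinite by fastforce
    ultimately have "5 \<le> card J" using \<open>{r,u,s,b,c} \<subseteq> J\<close> by (metis card_mono)
    then show False using J4 by simp
  qed
  obtain x1 x2 x3 x4 where J: "J = {x1,x2,x3,x4}"
    and d: "x1 \<noteq> x2" "x1 \<noteq> x3" "x1 \<noteq> x4" "x2 \<noteq> x3" "x2 \<noteq> x4" "x3 \<noteq> x4"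
    using J4 by (auto simp: card_Suc_eq numeral_eq_Suc)
  have out: "arrow p r s \<or> arrow p r u \<or> arrow p r v" if "J = {r,s,u,v}" for r s u v
    using ex[of r] inJ[of r] arrow_ne[of p r] that by auto
  have fan2: "arrow p r u \<longrightarrow> \<not> arrow p r s \<longrightarrow> \<not> arrow p r v \<longrightarrow> arrow p u s"
    if "J = {r,s,u,v}" "s \<noteq> r" "s \<noteq> u" for r s u v
  proof (intro impI)
    assume "arrow p r u" "\<not> arrow p r s" "\<not> arrow p r v"
    moreover have "\<not> arrow p r r" using arrow_ne[of p r r] by auto
    ultimately show "arrow p u s" using that by (intro fan[of r u s]) auto
  qed
  \<comment> \<open>the two constraints for all labellings of the four vertices make the claim propositional\<close>
  have J1: "J = {x1,x2,x3,x4}" "J = {x1,x2,x4,x3}" "J = {x1,x3,x2,x4}" "J = {x1,x3,x4,x2}" "J = {x1,x4,x2,x3}" "J = {x1,x4,x3,x2}"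
    "J = {x2,x1,x3,x4}" "J = {x2,x1,x4,x3}" "J = {x2,x3,x1,x4}" "J = {x2,x3,x4,x1}" "J = {x2,x4,x1,x3}" "J = {x2,x4,x3,x1}"
    "J = {x3,x1,x2,x4}" "J = {x3,x1,x4,x2}" "J = {x3,x2,x1,x4}" "J = {x3,x2,x4,x1}" "J = {x3,x4,x1,x2}" "J = {x3,x4,x2,x1}"
    "J = {x4,x1,x2,x3}" "J = {x4,x1,x3,x2}" "J = {x4,x2,x1,x3}" "J = {x4,x2,x3,x1}" "J = {x4,x3,x1,x2}" "J = {x4,x3,x2,x1}"
    using J by (simp_all add: insert_commute)
  note o = out[OF J1(1)] out[OF J1(7)] out[OF J1(13)] out[OF J1(19)]
  note f = J1[THEN fan2]
  note as = arrow_asym[of p x1 x2] arrow_asym[of p x1 x3] arrow_asym[of p x1 x4] arrow_asym[of p x2 x3] arrow_asym[of p x2 x4] arrow_asym[of p x3 x4]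
  show False using o f as d d[symmetric] by satx
qed

text \<open>
  The points p and p1 meet the same cube but differ in the layer of the letter e of coordinate d.
  At p the coordinate a has an arrow to b and none to c, at p1 none to b. A move in a that changes
  the letter of b at p therefore distinguishes p from p1, so it has to read e in coordinate d. Since not
  all four coordinates of J are cut at once, the letters of b (at p) and c (at p1) are then those of
  the brick.
\<close>

lemma flip_word:
  assumes c: "cut_brick J lam kap" and p: "brick lam kap p" and cp: "cut lam p = {a,b,c}"
    and J: "J = {a,b,c,d}" "J \<subseteq> A" and dist: "a \<noteq> b" "a \<noteq> c" "b \<noteq> c" "d \<noteq> a" "d \<noteq> b" "d \<noteq> c"
    and no4: "\<And>p. brick lam kap p \<Longrightarrow> cut lam p \<noteq> J"
    and e: "e \<noteq> lam d" and p1: "p1 = upd p d e l"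
    and ab: "arrow p a b" and nac: "\<not> arrow p a c" and nab1: "\<not> arrow p1 a b"
  obtains k where "L (upd p a (L p a) k) = (L p)(b := lam b, d := e)"
    "L (upd p1 a (L p a) k) = (L p)(c := lam c, d := e)"
proof -
  have inA: "a \<in> A" "b \<in> A" "c \<in> A" "d \<in> A" using J by auto
  have ca: "a \<in> cut lam p" using cp by simp
  have ne: "L p a \<noteq> lam a" "L p b \<noteq> lam b" "L p c \<noteq> lam c"
    using cut_memD(1)[of _ lam p] cp by auto
  have dp: "L p d = lam d"
  proof (rule ccontr)
    assume "L p d \<noteq> lam d"
    then have "d \<in> cut lam p" using inA by (simp add: cut_def)
    then show False using cp dist by auto
  qed
  have out: "L q i = L p i" if "i \<notin> J" "brick lam kap q" for i q
  proof (cases "i \<in> A")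
    case True
    have "L r i = lam i" if "brick lam kap r" for r
      using cut_brickD(1)[OF c that] \<open>i \<notin> J\<close> True by (auto simp: cut_def)
    then show ?thesis using p that by simp
  qed (simp add: outside)
  have Lp1: "L p1 = L p" unfolding p1 by (rule upd_unread) (simp add: dp e)
  have p1b: "brick lam kap p1" unfolding p1 using p e by (rule brick_upd)
  obtain k where k: "L (upd p a (L p a) k) b \<noteq> L p b" using ab by (auto simp: arrow_def)
  define q where "q = upd p a (L p a) k"
  define q1 where "q1 = upd p1 a (L p a) k"
  have qb: "brick lam kap q" unfolding q_def using p ca by (rule brick_step)
  have q1b: "brick lam kap q1" unfolding q1_def using p1b ne(1) by (rule brick_upd)
  have q1: "q1 = upd q d e l" unfolding q1_def q_def p1 using dist by (intro upd_commute) auto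
  have qa: "L q a = L p a" by (simp add: q_def)
  have qc: "L q c = L p c" unfolding q_def using nac by (rule not_arrow) simp
  have q1a: "L q1 a = L p a" by (simp add: q1_def Lp1)
  have "L q1 b = L p1 b" unfolding q1_def using nab1 by (rule not_arrow) simp
  then have q1b': "L q1 b = L p b" by (simp add: Lp1)
  have qd: "L q d = e"
  proof (rule ccontr)
    assume "L q d \<noteq> e"
    then have "L q1 = L q" unfolding q1 by (intro upd_unread) simp
    then show False using k q1b' q_def by simp
  qed
  have q1d: "L q1 d = e" using qd by (simp add: q1)
  have qB: "L q b = lam b"
  proof (rule ccontr)
    assume "L q b \<noteq> lam b"
    then have "J \<subseteq> cut lam q" using inA ne qa qc qd e by (auto simp: J(1) cut_def)
    then show False using no4[OF qb] cut_brickD(1)[OF c qb] by blast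
  qed
  have q1C: "L q1 c = lam c"
  proof (rule ccontr)
    assume "L q1 c \<noteq> lam c"
    then have "J \<subseteq> cut lam q1" using inA ne q1a q1b' q1d e by (auto simp: J(1) cut_def)
    then show False using no4[OF q1b] cut_brickD(1)[OF c q1b] by blast
  qed
  have "L q = (L p)(b := lam b, d := e)"
  proof
    fix i show "L q i = ((L p)(b := lam b, d := e)) i"
      using qa qB qc qd out[OF _ qb, of i] by (cases "i \<in> J") (auto simp: J(1))
  qed
  moreover have "L q1 = (L p)(c := lam c, d := e)"
  proof
    fix i show "L q1 i = ((L p)(c := lam c, d := e)) i"
      using q1a q1C q1b' q1d out[OF _ q1b, of i] by (cases "i \<in> J") (auto simp: J(1))
  qed
  ultimately show ?thesis using that by (simp add: q_def q1_def)
qed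

text \<open>
  Let P be a point on the cube of p or on one of its neighbours in direction d, with a letter in a that
  differs from that of p and a letter in d other than e. The layers of the letters of p in a, and of e in d, are then not read at P, so
  they may be set to those of the flipped cube. Then P differs from a point of that cube only along
  the line in direction b.
\<close>

lemma flip_word_forces:
  assumes p: "brick lam kap p" and b: "b \<in> A" "b \<noteq> a" "b \<noteq> d" "a \<noteq> d" "L p b \<noteq> lam b"
    and W: "L (upd p a (L p a) k) = (L p)(b := lam b, d := e)"
    and P: "\<And>i. i \<in> A \<Longrightarrow> i \<noteq> d \<Longrightarrow> P i (L p i) = p i (L p i)" and Pd: "L P d \<noteq> e" and Pa: "L P a \<noteq> L p a"
  shows "L P b = lam b"
proof -
  define R where "R = upd (upd P a (L p a) k) d e (p d e)"
  define Q where "Q = upd R b (lam b) (kap b)"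
  have 1: "L (upd P a (L p a) k) = L P" using Pa by (intro upd_unread) auto
  have "L R = L (upd P a (L p a) k)" unfolding R_def using Pd by (intro upd_unread) (auto simp: 1)
  then have R: "L R = L P" using 1 by simp
  have "L Q = L (upd p a (L p a) k)"
  proof (rule determined)
    fix i assume i: "i \<in> A"
    show "Q i (L (upd p a (L p a) k) i) = upd p a (L p a) k i (L (upd p a (L p a) k) i)"
      using P[OF i] i b p unfolding W Q_def R_def by (auto simp: upd_eq brick_def)
  qed
  then have "L Q b = lam b" using b(3) by (simp add: W)
  then show ?thesis by (simp add: Q_def R)
qed

text \<open>
  Let the arrows form the cycle a, b, c at p and the reversed cycle at p1, with p and p1 as in
  \<open>flip_word\<close>. That lemma yields six cubes. They force every neighbour brick of
  the cube of p in direction d to have the letters of p in a, b, c, so that only two coordinates are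
  left in which these bricks could be cut, and by \<open>rigid_2\<close> all of them are cubes
  of the tiling. They form a column in direction d.
\<close>

lemma double_cycle:
  assumes c: "cut_brick J lam kap" and p: "brick lam kap p" and cp: "cut lam p = {a,b,c}"
    and J: "J = {a,b,c,d}" "J \<subseteq> A" and dist: "a \<noteq> b" "a \<noteq> c" "b \<noteq> c" "d \<noteq> a" "d \<noteq> b" "d \<noteq> c"
    and A6: "card A \<le> 6"
    and no4: "\<And>p. brick lam kap p \<Longrightarrow> cut lam p \<noteq> J"
    and e: "e \<noteq> lam d" and p1: "p1 = upd p d e l"
    and cyc: "arrow p a b" "arrow p b c" "arrow p c a"
    and cyc1: "arrow p1 b a" "arrow p1 c b" "arrow p1 a c"
  shows False
proof -
  have inA: "a \<in> A" "b \<in> A" "c \<in> A" "d \<in> A" using J by auto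
  have ne: "L p a \<noteq> lam a" "L p b \<noteq> lam b" "L p c \<noteq> lam c"
    using cut_memD(1)[of _ lam p] cp by auto
  have dp: "L p d = lam d"
  proof (rule ccontr)
    assume "L p d \<noteq> lam d"
    then have "d \<in> cut lam p" using inA by (simp add: cut_def)
    then show False using cp dist by auto
  qed
  have Lp1: "L p1 = L p" unfolding p1 by (rule upd_unread) (simp add: dp e)
  have p1b: "brick lam kap p1" unfolding p1 using p e by (rule brick_upd)
  have n: "\<not> arrow p a c" "\<not> arrow p b a" "\<not> arrow p c b" "\<not> arrow p1 a b" "\<not> arrow p1 b c" "\<not> arrow p1 c a"
    using cyc cyc1 arrow_asym by metis+
  obtain ka where ka: "L (upd p a (L p a) ka) = (L p)(b := lam b, d := e)"
    "L (upd p1 a (L p a) ka) = (L p)(c := lam c, d := e)"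
    by (rule flip_word[OF c p cp J dist no4 e p1 cyc(1) n(1) n(4)])
  obtain kb where kb: "L (upd p b (L p b) kb) = (L p)(c := lam c, d := e)"
    "L (upd p1 b (L p b) kb) = (L p)(a := lam a, d := e)"
    by (rule flip_word[OF c p _ _ J(2) _ _ _ _ _ _ no4 e p1 cyc(2) n(2) n(5)])
      (use cp J(1) dist in auto)
  obtain kc where kc: "L (upd p c (L p c) kc) = (L p)(a := lam a, d := e)"
    "L (upd p1 c (L p c) kc) = (L p)(b := lam b, d := e)"
    by (rule flip_word[OF c p _ _ J(2) _ _ _ _ _ _ no4 e p1 cyc(3) n(3) n(6)])
      (use cp J(1) dist in auto)
  \<comment> \<open>points of the cube of p and of its neighbour bricks in direction d\<close>
  define nb where "nb P \<longleftrightarrow> (\<forall>i\<in>A. i \<noteq> d \<longrightarrow> P i (L p i) = p i (L p i))" for P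
  have nbd: "L P d = lam d" if "nb P" for P
  proof -
    have "L (upd P d (lam d) (p d (lam d))) = L p"
      by (rule determined) (use that dp in \<open>auto simp: nb_def upd_eq\<close>)
    then show ?thesis by (metis letter_upd dp)
  qed
  have force: "L P y = lam y" if "nb P" "L P x \<noteq> L p x"
    "L (upd p x (L p x) k) = (L p)(y := lam y, d := e)" "y \<in> A" "y \<noteq> x" "y \<noteq> d" "x \<noteq> d" "L p y \<noteq> lam y"
    for P x y k
    by (rule flip_word_forces[OF p, of y x d k e P]) (use that e nbd in \<open>auto simp: nb_def\<close>)
  have p1i: "p1 i = p i" if "i \<noteq> d" for i using that by (simp add: p1)
  have force1: "L P y = lam y" if "nb P" "L P x \<noteq> L p x"
    "L (upd p1 x (L p x) k) = (L p)(y := lam y, d := e)" "y \<in> A" "y \<noteq> x" "y \<noteq> d" "x \<noteq> d" "L p y \<noteq> lam y"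
    for P x y k
    by (rule flip_word_forces[OF p1b, of y x d k e P]) (use that e nbd p1i in \<open>auto simp: nb_def Lp1\<close>)
  have a_main: "L P a = L p a" if P: "nb P" for P
  proof (rule ccontr)
    assume "L P a \<noteq> L p a"
    \<comment> \<open>If the letter of a changes, then b and c read the letters of the brick. Resetting the layer of
      lam a leads into the cube flipped by c, which has the letter e in d.\<close>
    define P1 where "P1 = upd P a (lam a) (kap a)"
    have nb1: "nb P1" using P ne by (auto simp: nb_def P1_def upd_eq)
    have a1: "L P1 a \<noteq> L p a" using \<open>L P a \<noteq> L p a\<close> by (simp add: P1_def)
    have b1: "L P1 b = lam b" by (rule force[OF nb1 a1 ka(1)]) (use inA dist ne in auto)
    have c1: "L P1 c = lam c" by (rule force1[OF nb1 a1 ka(2)]) (use inA dist ne in auto)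
    define P2 where "P2 = upd P1 c (L p c) kc"
    define P3 where "P3 = upd P2 d e (p d e)"
    have 2: "L P2 = L P1" unfolding P2_def by (rule upd_unread) (use c1 ne in auto)
    have 3: "L P3 = L P2" unfolding P3_def by (rule upd_unread) (use 2 nbd[OF nb1] e in auto)
    have "L P3 = L (upd p c (L p c) kc)"
    proof (rule determined)
      fix i assume i: "i \<in> A"
      show "P3 i (L (upd p c (L p c) kc) i) = upd p c (L p c) kc i (L (upd p c (L p c) kc) i)"
        using nb1 p inA i dist unfolding kc P3_def P2_def by (auto simp: upd_eq nb_def brick_def P1_def)
    qed
    then have "L P3 d = e" by (simp add: kc)
    then show False using 2 3 nbd[OF nb1] e by simp
  qed
  have b_main: "L P b = L p b" if P: "nb P" for P
  proof (rule ccontr)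
    assume "L P b \<noteq> L p b"
    have "L P a = lam a" by (rule force1[OF P \<open>L P b \<noteq> L p b\<close> kb(2)]) (use inA dist ne in auto)
    then show False using a_main[OF P] ne by simp
  qed
  have c_main: "L P c = L p c" if P: "nb P" for P
  proof (rule ccontr)
    assume "L P c \<noteq> L p c"
    have "L P a = lam a" by (rule force[OF P \<open>L P c \<noteq> L p c\<close> kc(1)]) (use inA dist ne in auto)
    then show False using a_main[OF P] ne by simp
  qed
  have "L (upd p d (L p d) k) = L p" for k
  proof -
    define kap' where "kap' = (\<lambda>i. upd p d (L p d) k i (L p i))"
    have b0: "brick (L p) kap' (upd p d (L p d) k)" by (simp add: brick_def kap'_def)
    have nbb: "nb P" if "brick (L p) kap' P" for P using that by (auto simp: nb_def brick_def kap'_def)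
    have sub: "cut (L p) P \<subseteq> A - J" if "brick (L p) kap' P" for P
      using nbd[OF nbb[OF that]] a_main[OF nbb[OF that]] b_main[OF nbb[OF that]] c_main[OF nbb[OF that]] dp J
      by (auto simp: cut_def)
    have "card (A - J) \<le> 2" using card_Diff_subset[of J A] J dist A6 by (simp add: finite_subset)
    then have "\<not> cut_brick (A - J) (L p) kap'" using rigid_2 finite_A unfolding rigid_def by blast
    then have "cut (L p) (upd p d (L p d) k) = {}" using cut_brickI[OF sub b0] by blast
    then have "L (upd p d (L p d) k) i = L p i" for i using outside by (cases "i \<in> A") (auto simp: cut_def)
    then show ?thesis by blast
  qed
  then show False using no_column[OF inA(4), of p] by simp
qed

text \<open>
  The brick of the lone arrow is cut in at least two and at most three of the four coordinates of J,
  and somewhere in exactly three, say a, b, c. Each of them has an arrow into the three, so they form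
  a cycle, and by \<open>lone_out_fan\<close> one of them, say b, has an arrow to the fourth
  coordinate d. After the corresponding move the coordinates a, b, d form a cycle, in which d has an
  arrow to a. Seen from the original point, this says that a change in d alone reverses the
  cycle.
\<close>

lemma lone_out_6:
  assumes r3: "rigid 3" and A6: "card A = 6" and a: "a \<in> A" and lone: "\<And>b. arrow z a b \<Longrightarrow> b = t"
  shows False
proof -
  have "arrow z a t" using arrow_ex[OF a, of z] lone by metis
  then have ne: "a \<noteq> t" and t: "t \<in> A" using arrow_ne[of z a t] arrow_in[of z a t] by auto
  define J where "J = A - {a,t}"
  have J4: "card J = 4" and fJ: "finite J" and JA: "J \<subseteq> A"
    using card_Diff_pair[OF a t ne] A6 finite_A by (auto simp: J_def)
  define lam where "lam = L z"
  obtain kap where c: "cut_brick J lam kap" using lone_out_cut_brick[OF a lone] J_def lam_def by metis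
  have two: "2 \<le> card (cut lam p)" if "brick lam kap p" for p
    by (rule cut_ge_2[OF r3 c fJ _ that]) (simp add: J4)
  have no4: "cut lam p \<noteq> J" if "brick lam kap p" for p using full_cut_4[OF r3 A6 c J4 that] by blast
  \<comment> \<open>an arrow to d that starts to cut d has to stop cutting another coordinate\<close>
  have inner: "arrow p x y \<or> arrow p x w" if p: "brick lam kap p" and cp: "cut lam p = {x,y,w}" and d: "J = {x,y,w,d}"
    "x \<noteq> y" "y \<noteq> w" "x \<noteq> w" "d \<notin> {x,y,w}" for p x y w d
  proof (rule ccontr)
    assume n: "\<not> (arrow p x y \<or> arrow p x w)"
    have xc: "x \<in> cut lam p" using cp by simp
    obtain b where xb: "arrow p x b" using arrow_ex[OF cut_memD(2)[OF xc]] by blast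
    have "b \<in> J" using cut_arrow[OF c p xc xb] .
    then have bd: "b = d" using d n xb arrow_ne[OF xb] by auto
    obtain k where k: "L (upd p x (L p x) k) d \<noteq> L p d" using xb bd by (auto simp: arrow_def)
    define q where "q = upd p x (L p x) k"
    have qb: "brick lam kap q" unfolding q_def using p xc by (rule brick_step)
    have "d \<notin> cut lam p" using cp d(5) by auto
    then have "L p d = lam d" using JA d(1) by (auto simp: cut_def)
    then have "d \<in> cut lam q" using k JA d(1) by (auto simp: q_def cut_def)
    moreover have "x \<in> cut lam q" unfolding q_def using xc by (rule cut_keep)
    moreover have "L q y = L p y" "L q w = L p w" using n by (auto simp: q_def intro: not_arrow)
    moreover have "y \<in> cut lam p" "w \<in> cut lam p" using cp by auto
    ultimately have "J \<subseteq> cut lam q" using d(1) by (auto simp: cut_def)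
    then show False using no4[OF qb] cut_brickD(1)[OF c qb] by blast
  qed
  have cycle: "arrow p x y \<and> arrow p y w \<and> arrow p w x \<or> arrow p y x \<and> arrow p w y \<and> arrow p x w"
    if p: "brick lam kap p" and cp: "cut lam p = {x,y,w}" and d: "J = {x,y,w,d}"
    "x \<noteq> y" "y \<noteq> w" "x \<noteq> w" "d \<notin> {x,y,w}" for p x y w d
    using inner[OF that] inner[OF p, of y w x d] inner[OF p, of w x y d] cp d
      arrow_asym[of p x y] arrow_asym[of p y w] arrow_asym[of p w x] by (auto simp: insert_commute)
  obtain p where p: "brick lam kap p" and p3: "3 \<le> card (cut lam p)"
    using three_cut_point[OF c two] by blast
  have "card (cut lam p) \<le> 4" using cut_brickD(1)[OF c p] J4 fJ by (metis card_mono)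
  moreover have "card (cut lam p) \<noteq> 4" using cut_brickD(1)[OF c p] J4 fJ no4[OF p] by (metis card_subset_eq)
  ultimately have cp3: "card (cut lam p) = 3" using p3 by simp
  then obtain x y w where cp: "cut lam p = {x,y,w}" and d1: "x \<noteq> y" "y \<noteq> w" "x \<noteq> w" by (auto simp: card_3_iff)
  have "card (J - cut lam p) = 1" using cut_brickD(1)[OF c p] J4 cp3 by (simp add: card_Diff_subset)
  then obtain d where Jd: "J - cut lam p = {d}" by (auto simp: card_1_singleton_iff)
  then have J: "J = {x,y,w,d}" and d2: "d \<notin> {x,y,w}" using cut_brickD(1)[OF c p] cp by auto
  \<comment> \<open>otherwise all arrows of the cycle are lone ones\<close>
  have "\<exists>r \<in> {x,y,w}. arrow p r d"
  proof (rule ccontr)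
    assume n: "\<not> ?thesis"
    have lone1: "False" if cyc: "arrow p x y" "arrow p y w" "arrow p w x" and s: "{x,y,w} = cut lam p" for x y w
    proof -
      have o: "b = y" if "arrow p x b" for b
      proof -
        have "x \<in> cut lam p" using s by auto
        then have "b \<in> J" by (rule cut_arrow[OF c p _ that])
        moreover have "b \<noteq> d" using n that s cp by auto
        ultimately have "b \<in> cut lam p" using Jd by blast
        then have "b \<in> {x,y,w}" by (simp add: s)
        moreover have "b \<noteq> w" using arrow_asym[OF cyc(3)] that by auto
        ultimately show ?thesis using arrow_ne[OF that] by auto
      qed
      have o2: "b = w" if "arrow p y b" for b
      proof -
        have "y \<in> cut lam p" using s by auto
        then have "b \<in> J" by (rule cut_arrow[OF c p _ that])
        moreover have "b \<noteq> d" using n that s cp by auto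
        ultimately have "b \<in> cut lam p" using Jd by blast
        then have "b \<in> {x,y,w}" by (simp add: s)
        moreover have "b \<noteq> x" using arrow_asym[OF cyc(1)] that by auto
        ultimately show ?thesis using arrow_ne[OF that] by auto
      qed
      have "x \<in> A" "card A \<le> 3 + 3" using s A6 by (auto simp: cut_def)
      from lone_out_fan[OF r3 this(2,1) o] o2 show False by metis
    qed
    show False using cycle[OF p cp J d1 d2] lone1[of x y w] lone1[of x w y] cp by (auto simp: insert_commute)
  qed
  then obtain a b c' where cyc: "arrow p a b" "arrow p b c'" "arrow p c' a" and bd: "arrow p b d" and s: "{a,b,c'} = {x,y,w}"
    using cycle[OF p cp J d1 d2] by (auto simp: insert_commute)
  have dist: "a \<noteq> b" "a \<noteq> c'" "b \<noteq> c'" "d \<noteq> a" "d \<noteq> b" "d \<noteq> c'"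
    using arrow_ne[OF cyc(1)] arrow_ne[OF cyc(2)] arrow_ne[OF cyc(3)] d2 s by auto
  have cp': "cut lam p = {a,b,c'}" and J': "J = {a,b,c',d}" using s cp J by auto
  have inA: "a \<in> A" "b \<in> A" "c' \<in> A" "d \<in> A" using JA J' by auto
  have ne1: "L p a \<noteq> lam a" "L p b \<noteq> lam b" "L p c' \<noteq> lam c'"
    using cut_memD(1)[of _ lam p] cp' by auto
  have "d \<notin> cut lam p" using cp' dist by auto
  then have dp: "L p d = lam d" using inA by (simp add: cut_def)
  obtain k where k: "L (upd p b (L p b) k) d \<noteq> L p d" using bd by (auto simp: arrow_def)
  define q where "q = upd p b (L p b) k"
  define e where "e = L q d"
  have e: "e \<noteq> lam d" using k dp by (simp add: e_def q_def)
  have qb: "brick lam kap q" unfolding q_def using p ne1(2) by (rule brick_upd)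
  have nba: "\<not> arrow p b a" using arrow_asym[OF cyc(1)] .
  have qa: "L q a = L p a" unfolding q_def using nba by (rule not_arrow) simp
  have qB: "L q b = L p b" by (simp add: q_def)
  have qc: "L q c' = lam c'"
  proof (rule ccontr)
    assume "L q c' \<noteq> lam c'"
    then have "J \<subseteq> cut lam q" using inA ne1 qa qB e by (auto simp: J' cut_def e_def)
    then show False using no4[OF qb] cut_brickD(1)[OF c qb] by blast
  qed
  have cq: "cut lam q = {a,b,d}"
    using cut_brickD(1)[OF c qb] inA ne1 qa qB qc e by (auto simp: J' cut_def e_def)
  have "arrow q b d" unfolding q_def by (rule arrow_same[OF bd]) simp
  then have "arrow q d a"
    using cycle[OF qb cq, of c'] dist J' arrow_asym[of q b d] by (auto simp: insert_commute)
  then obtain l where l: "L (upd q d e l) a \<noteq> L q a" by (auto simp: arrow_def e_def)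
  define p1 where "p1 = upd p d e l"
  have Lp1: "L p1 = L p" unfolding p1_def by (rule upd_unread) (simp add: dp e)
  have p1b: "brick lam kap p1" unfolding p1_def using p e by (rule brick_upd)
  \<comment> \<open>the moves in b and d commute, so the change of a seen at q is an arrow from b to a at p1\<close>
  have "upd q d e l = upd p1 b (L p b) k" unfolding q_def p1_def using dist by (intro upd_commute) auto
  then have ba1: "arrow p1 b a" using l qa by (auto simp: arrow_def Lp1)
  have cp1: "cut lam p1 = {a,b,c'}" using cp' by (simp add: cut_def Lp1)
  have "d \<notin> {a,b,c'}" using dist by auto
  then have cyc1: "arrow p1 b a" "arrow p1 c' b" "arrow p1 a c'"
    using cycle[OF p1b cp1 J' dist(1,3,2)] ba1 arrow_asym[of p1 b a] by auto
  show False
    by (rule double_cycle[OF c p cp' J' JA dist _ no4 e p1_def cyc cyc1]) (simp_all add: A6)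
qed

section \<open>Three-dimensional sections through a brick cut in three coordinates\<close>

text \<open>
  A point where a brick supported on three coordinates is cut in all of them, together with the
  orientation of the 3-cycle that the arrows between them then form.
\<close>

definition hub :: "'i \<Rightarrow> 'i \<Rightarrow> 'i \<Rightarrow> ('i \<Rightarrow> 'a) \<Rightarrow> ('i \<Rightarrow> 'b) \<Rightarrow> ('i \<Rightarrow> 'a \<Rightarrow> 'b) \<Rightarrow> bool" where
  "hub a b c lam kap p \<longleftrightarrow> cut_brick {a,b,c} lam kap \<and> brick lam kap p \<and> cut lam p = {a,b,c} \<and>
    a \<noteq> b \<and> b \<noteq> c \<and> a \<noteq> c \<and> arrow p a b \<and> arrow p b c \<and> arrow p c a"

lemma hub_rot: "hub a b c lam kap p \<Longrightarrow> hub b c a lam kap p"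
  by (auto simp: hub_def insert_commute)

lemma hubI:
  assumes c: "cut_brick {a,b,c} lam kap" "brick lam kap p" "cut lam p = {a,b,c}" and d: "a \<noteq> b" "b \<noteq> c" "a \<noteq> c" and ab: "arrow p a b"
  shows "hub a b c lam kap p"
proof -
  have ex: "\<exists>y. arrow p x y \<and> y \<in> {a,b,c} \<and> y \<noteq> x" if x: "x \<in> {a,b,c}" for x
  proof -
    have xc: "x \<in> cut lam p" using x c(3) by simp
    obtain y where xy: "arrow p x y" using arrow_ex[OF cut_memD(2)[OF xc]] by blast
    show ?thesis using xy cut_arrow[OF c(1,2) xc xy] arrow_ne[OF xy] by auto
  qed
  have "arrow p b c" using ex[of b] arrow_asym[OF ab] d by auto
  moreover have "arrow p c a" using ex[of c] arrow_asym[OF calculation] d by auto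
  ultimately show ?thesis using assms by (simp add: hub_def)
qed

lemma hub_ex:
  assumes c: "cut_brick {a,b,c} lam kap" and d: "a \<noteq> b" "b \<noteq> c" "a \<noteq> c"
  obtains p where "hub a b c lam kap p \<or> hub a c b lam kap p"
proof -
  have two: "2 \<le> card (cut lam p)" if "brick lam kap p" for p
    by (rule cut_ge_2[OF rigid_2 c _ _ that]) (use d in auto)
  obtain p where p: "brick lam kap p" and p3: "3 \<le> card (cut lam p)"
    using three_cut_point[OF c two] by blast
  have cp: "cut lam p = {a,b,c}" using cut_brickD(1)[OF c p] p3 d by (intro card_seteq) auto
  have ac: "a \<in> cut lam p" using cp by simp
  obtain y where ay: "arrow p a y" using arrow_ex[OF cut_memD(2)[OF ac]] by blast
  have "y = b \<or> y = c" using cut_arrow[OF c p ac ay] arrow_ne[OF ay] by auto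
  moreover have "hub a b c lam kap p" if "y = b" using ay that by (intro hubI c p cp d) simp
  moreover have "hub a c b lam kap p" if "y = c"
  proof (rule hubI)
    show "cut_brick {a,c,b} lam kap" using c by (simp add: insert_commute)
    show "cut lam p = {a,c,b}" using cp by (simp add: insert_commute)
  qed (use p d ay that in auto)
  ultimately show ?thesis using that by blast
qed

lemma hub_basics:
  assumes h: "hub a b c lam kap p"
  shows "a \<in> A" "L p a \<noteq> lam a" "\<not> arrow p a c" "\<not> arrow p b a" "cut_brick {a,b,c} lam kap" "brick lam kap p"
    "a \<noteq> b" "b \<noteq> c" "a \<noteq> c" "\<And>i q. i \<notin> {a,b,c} \<Longrightarrow> brick lam kap q \<Longrightarrow> L q i = L p i"
proof -
  have h': "cut_brick {a,b,c} lam kap" "brick lam kap p" "cut lam p = {a,b,c}" "a \<noteq> b" "b \<noteq> c" "a \<noteq> c" "arrow p a b" "arrow p b c" "arrow p c a"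
    using h by (auto simp: hub_def)
  have ac: "a \<in> cut lam p" using h'(3) by simp
  show "a \<in> A" "L p a \<noteq> lam a" using ac cut_memD[of a lam p] by auto
  show "\<not> arrow p a c" "\<not> arrow p b a" using arrow_asym[OF h'(9)] arrow_asym[OF h'(7)] by auto
  show "cut_brick {a,b,c} lam kap" "brick lam kap p" "a \<noteq> b" "b \<noteq> c" "a \<noteq> c" using h' by auto
  show "L q i = L p i" if "i \<notin> {a,b,c}" "brick lam kap q" for i q
  proof (cases "i \<in> A")
    case True
    have "L r i = lam i" if "brick lam kap r" for r
      using cut_brickD(1)[OF h'(1) that] \<open>i \<notin> {a,b,c}\<close> True by (auto simp: cut_def)
    then show ?thesis using h'(2) that by simp
  qed (simp add: outside)
qed

lemma hub_same:
  assumes h: "hub a b c lam kap p" and q: "brick lam kap q" "L q = L p" "arrow q a b"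
  shows "hub a b c lam kap q"
  using h q by (intro hubI) (auto simp: hub_def cut_def)

text \<open>
  Suppose that a move in a changes the letter of b to some e that belongs neither to p nor to the
  brick. The result q is a hub with the same orientation, so at q a change of the layer of e moves c.
  The same change of layer at p is not read, but the resulting hub has an arrow from a to c. Its
  orientation is thus reversed, so that the move in a can no longer change b.
\<close>

lemma hub_move:
  assumes h: "hub a b c lam kap p"
  shows "L (upd p a (L p a) k) = L p \<or> L (upd p a (L p a) k) = (L p)(b := lam b)"
proof -
  note B = hub_basics[OF h]
  define q where "q = upd p a (L p a) k"
  have h': "arrow p a b" "cut lam p = {a,b,c}" using h by (auto simp: hub_def)
  have qb: "brick lam kap q" unfolding q_def using B(6,2) by (rule brick_upd)
  have qa: "L q a = L p a" by (simp add: q_def)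
  have qc: "L q c = L p c" unfolding q_def using B(3) by (rule not_arrow) simp
  have "L q b = L p b \<or> L q b = lam b"
  proof (rule ccontr)
    assume n: "\<not> ?thesis"
    define e where "e = L q b"
    have inA: "b \<in> A" "c \<in> A" "L p b \<noteq> lam b" "L p c \<noteq> lam c"
      using hub_basics(1,2)[OF hub_rot[OF h]] hub_basics(1,2)[OF hub_rot[OF hub_rot[OF h]]] by auto
    have "{a,b,c} \<subseteq> cut lam q" using inA B n qa qc by (auto simp: cut_def)
    then have "cut lam q = {a,b,c}" using cut_brickD(1)[OF B(5) qb] by blast
    moreover have "arrow q a b" unfolding q_def by (rule arrow_same[OF h'(1)]) simp
    ultimately have "hub a b c lam kap q" using hubI[OF B(5) qb] B(7-9) by blast
    then obtain l where l: "L (upd q b e l) c \<noteq> L q c" by (auto simp: hub_def arrow_def e_def)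
    define p2 where "p2 = upd p b e l"
    have 2: "L p2 = L p" unfolding p2_def by (rule upd_unread) (use n in \<open>auto simp: e_def\<close>)
    have b2: "brick lam kap p2" unfolding p2_def using B(6) n by (intro brick_upd) (auto simp: e_def)
    have eq: "upd q b e l = upd p2 a (L p2 a) k" unfolding q_def p2_def 2[unfolded p2_def]
      using B(7) by (intro upd_commute)
    have ac: "arrow p2 a c" using l qc 2 by (auto simp: eq arrow_def)
    have "hub a c b lam kap p2"
    proof (rule hubI)
      show "cut_brick {a,c,b} lam kap" using B(5) by (simp add: insert_commute)
      show "cut lam p2 = {a,c,b}" using h' 2 by (auto simp: cut_def)
    qed (use b2 B ac in auto)
    then have "\<not> arrow p2 a b" by (rule hub_basics)
    then have "L (upd p2 a (L p2 a) k) b = L p2 b" by (rule not_arrow) simp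
    moreover have "L (upd q b e l) b = e" by (simp add: e_def)
    ultimately have "L p b = e" using 2 unfolding eq by simp
    then show False using n by (simp add: e_def)
  qed
  moreover have "L q i = L p i" if "i \<noteq> b" for i
    using qa qc B(10)[OF _ qb, of i] that by (cases "i \<in> {a,b,c}") auto
  ultimately have "L q = L p \<or> L q = (L p)(b := lam b)" by (metis (no_types) ext fun_upd_apply)
  then show ?thesis by (simp add: q_def)
qed

text \<open>
  The layers to which the letter in coordinate j can be moved without leaving the letters of p.
  At a hub this means without disturbing the successor of j in the cycle.
\<close>

definition still :: "('i \<Rightarrow> 'a \<Rightarrow> 'b) \<Rightarrow> 'i \<Rightarrow> 'b set" where
  "still p j = {k. L (upd p j (L p j) k) = L p}"

lemma arrow_not_still: "arrow p j i \<Longrightarrow> \<exists>k. k \<notin> still p j"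
  unfolding arrow_def still_def mem_Collect_eq by metis

text \<open>
  Moving p in the coordinates a and b to the layers of P leads to a point s. If the layer in a is
  still, then the first move leads to another hub, and from there the second one has the same effect
  on c as a move of p in b alone. Otherwise one of the two points would be a hub whose arrows from a
  go both to b and to c.
\<close>

lemma hub_still:
  assumes h: "hub a b c lam kap p" and P: "brick lam kap P" and a: "P a (L p a) \<in> still p a"
  shows "L P c = (if P b (L p b) \<in> still p b then L p c else lam c)"
proof -
  note B = hub_basics[OF h]
  note B1 = hub_basics[OF hub_rot[OF h]]
  note B2 = hub_basics[OF hub_rot[OF hub_rot[OF h]]]
  have ar: "arrow p a b" "arrow p b c" using h by (auto simp: hub_def)
  define q where "q = upd p a (L p a) (P a (L p a))"
  define r where "r = upd p b (L p b) (P b (L p b))"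
  have Lq: "L q = L p" using a by (simp add: still_def q_def)
  have qb: "brick lam kap q" unfolding q_def using B(6,2) by (rule brick_upd)
  have rb: "brick lam kap r" unfolding r_def using B(6) B1(2) by (rule brick_upd)
  have hq: "hub a b c lam kap q"
    by (rule hub_same[OF h qb Lq]) (unfold q_def, rule arrow_same[OF ar(1)], simp)
  define s where "s = upd q b (L p b) (P b (L p b))"
  have s2: "s = upd r a (L p a) (P a (L p a))" unfolding s_def q_def r_def using B(7) by (rule upd_commute)
  have sb: "brick lam kap s" unfolding s_def using qb B1(2) by (rule brick_upd)
  have Ls: "L s = L p \<or> L s = (L p)(c := lam c)"
    using hub_move[OF hub_rot[OF hq], of "P b (L p b)"] by (simp add: Lq s_def)
  have Lr: "L r = L p \<or> L r = (L p)(c := lam c)"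
    using hub_move[OF hub_rot[OF h], of "P b (L p b)"] by (simp add: r_def)
  \<comment> \<open>r is p moved in b only; s and r lie on a line in direction a\<close>
  have sc: "L s c = L r c"
  proof (cases "P b (L p b) \<in> still p b")
    case True
    then have Lr: "L r = L p" by (simp add: still_def r_def)
    have "hub b c a lam kap r"
      by (rule hub_same[OF hub_rot[OF h] rb Lr]) (unfold r_def, rule arrow_same[OF ar(2)], simp)
    then have "\<not> arrow r a c" using hub_basics(4) hub_basics(3)[OF hub_rot[OF hub_rot]] by blast
    then show ?thesis unfolding s2 by (rule not_arrow) simp
  next
    case False
    then have "L r c = lam c" using Lr by (auto simp: still_def r_def)
    moreover have "L s \<noteq> L p"
    proof
      assume 1: "L s = L p"
      have "hub b c a lam kap s"
        by (rule hub_same[OF hub_rot[OF h] sb 1])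
          (unfold s_def, rule arrow_same[of q], use hq in \<open>auto simp: hub_def\<close>)
      then have "\<not> arrow s a c" using hub_basics(3)[OF hub_rot[OF hub_rot]] by blast
      then have "L r c = L s c" by (rule not_arrow) (simp add: s2)
      then show False using 1 \<open>L r c = lam c\<close> B2(2) by simp
    qed
    ultimately show ?thesis using Ls by auto
  qed
  show ?thesis
  proof (cases "P b (L p b) \<in> still p b")
    case True
    then have "L s = L p" using sc Ls B2(2) by (auto simp: still_def r_def fun_eq_iff)
    have "L (upd P c (L p c) (p c (L p c))) = L s"
    proof (rule determined)
      fix i assume i: "i \<in> A"
      show "upd P c (L p c) (p c (L p c)) i (L s i) = s i (L s i)"
      proof (cases "i \<in> {a,b,c}")
        case True then show ?thesis using B(7-9) unfolding \<open>L s = L p\<close> by (auto simp: s_def q_def upd_eq)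
      next
        case False
        then have "L p i = lam i" using B(5,6) i cut_brickD(1)[OF B(5,6)] by (auto simp: cut_def)
        then show ?thesis using False P sb i by (auto simp: \<open>L s = L p\<close> brick_def)
      qed
    qed
    then have "L P c = L s c" by (metis letter_upd)
    then show ?thesis using True \<open>L s = L p\<close> by simp
  next
    case False
    then have r1: "L r c = lam c" using Lr by (auto simp: still_def r_def)
    then have Ls: "L s = (L p)(c := lam c)" using sc Ls B2(2) by (metis fun_upd_same)
    have "L P = L s"
    proof (rule determined)
      fix i assume i: "i \<in> A"
      show "P i (L s i) = s i (L s i)"
      proof (cases "i \<in> {a,b}")
        case True then show ?thesis using B(7-9) unfolding Ls by (auto simp: s_def q_def upd_eq)
      next
        case False
        then have "L s i = lam i" using B(5,6) i cut_brickD(1)[OF B(5,6)] by (auto simp: Ls cut_def)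
        then show ?thesis using False P sb i by (auto simp: brick_def)
      qed
    qed
    then show ?thesis using False by (simp add: Ls)
  qed
qed

text \<open>
  Set the layer of c to that of p, which is still. Then b reads the letter of the brick, so its
  layer can be set to that of p as well without changing the cube, and now a reads the letter of p.
  This is the cube reached from p by a move in a to the layer of P, where c keeps its letter.
\<close>

lemma hub_moved:
  assumes h: "hub a b c lam kap p" and P: "brick lam kap P" and a: "P a (L p a) \<notin> still p a"
  shows "L P c = L p c"
proof -
  note B = hub_basics[OF h]
  note B1 = hub_basics[OF hub_rot[OF h]]
  note B2 = hub_basics[OF hub_rot[OF hub_rot[OF h]]]
  have st: "p j (L p j) \<in> still p j" for j by (simp add: still_def upd_def)
  define P1 where "P1 = upd P c (L p c) (p c (L p c))"
  have b1: "brick lam kap P1" unfolding P1_def using P B2(2) by (rule brick_upd)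
  have "L P1 b = lam b"
    using hub_still[OF hub_rot[OF hub_rot[OF h]] b1] a st B(7-9) by (simp add: P1_def)
  define P2 where "P2 = upd P1 b (L p b) (p b (L p b))"
  have L2: "L P2 = L P1" unfolding P2_def by (rule upd_unread) (use \<open>L P1 b = lam b\<close> B1(2) in auto)
  have b2: "brick lam kap P2" unfolding P2_def using b1 B1(2) by (rule brick_upd)
  have "L P2 a = L p a"
    using hub_still[OF hub_rot[OF h] b2] a st B(7-9) by (simp add: P1_def P2_def)
  define W where "W = upd p a (L p a) (P a (L p a))"
  have LW: "L W = (L p)(b := lam b)" using hub_move[OF h, of "P a (L p a)"] a by (auto simp: still_def W_def)
  have "L P2 = L W"
  proof (rule determined)
    fix i assume i: "i \<in> A"
    show "P2 i (L W i) = W i (L W i)"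
    proof (cases "i \<in> {a,c}")
      case True then show ?thesis using B(7-9) unfolding LW by (auto simp: W_def P2_def P1_def upd_eq)
    next
      case False
      then have "L W i = lam i" using B(5,6) i cut_brickD(1)[OF B(5,6)] unfolding LW by (auto simp: cut_def)
      moreover have "W i (lam i) = kap i" using False B(6) i by (auto simp: W_def upd_eq brick_def)
      ultimately show ?thesis using b2 i by (auto simp: brick_def)
    qed
  qed
  then have "L P2 c = L p c" using B(8) by (simp add: LW)
  then have "L P1 c = L p c" by (simp add: L2)
  then show ?thesis by (simp add: P1_def)
qed

text \<open>
  The section in the directions of J through the brick: only the coordinates outside J are bound to it.
\<close>

definition slab :: "'i set \<Rightarrow> ('i \<Rightarrow> 'a) \<Rightarrow> ('i \<Rightarrow> 'b) \<Rightarrow> ('i \<Rightarrow> 'a \<Rightarrow> 'b) \<Rightarrow> bool" where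
  "slab J lam kap P \<longleftrightarrow> (\<forall>i\<in>A - J. P i (lam i) = kap i)"

lemma hub_brick:
  assumes h: "hub a b c lam kap p" and P: "brick lam kap P"
  shows "L P c = (if P a (L p a) \<in> still p a \<and> P b (L p b) \<notin> still p b then lam c else L p c)"
  using hub_still[OF h P] hub_moved[OF h P] by (cases "P a (L p a) \<in> still p a") simp_all

lemma slab_reset:
  assumes P: "slab J lam kap P" and Q: "brick lam kap Q" "\<And>j. j \<in> J \<Longrightarrow> j \<in> A \<Longrightarrow> P j (L Q j) = Q j (L Q j)"
    and c: "cut_brick J lam kap"
  shows "L P = L Q"
proof (rule determined)
  fix i assume i: "i \<in> A"
  show "P i (L Q i) = Q i (L Q i)"
  proof (cases "i \<in> J")
    case False
    then have "L Q i = lam i" using cut_brickD(1)[OF c Q(1)] i by (auto simp: cut_def)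
    then show ?thesis using P Q(1) i False by (simp add: slab_def brick_def)
  qed (use Q i in auto)
qed

text \<open>
  In coordinate c nothing changes along the line in direction c, so the layer of lam c can be reset to
  that of the brick. The cube met in the brick then uses main letters in a and b and therefore
  contains the point whatever the layers of lam a and lam b are.
\<close>

lemma hub_slab_exceptional:
  assumes h: "hub a b c lam kap p" and P: "slab {a,b,c} lam kap P"
    and ab: "P a (L p a) \<in> still p a" "P b (L p b) \<notin> still p b"
  shows "L P c = lam c"
proof -
  note B = hub_basics[OF h]
  note B1 = hub_basics[OF hub_rot[OF h]]
  note B2 = hub_basics[OF hub_rot[OF hub_rot[OF h]]]
  define P1 where "P1 = upd P c (lam c) (kap c)"
  define Q where "Q = upd (upd P1 a (lam a) (kap a)) b (lam b) (kap b)"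
  have Q: "brick lam kap Q" using P B(7-9) by (auto simp: brick_def Q_def P1_def upd_eq slab_def)
  have ly: "Q a (L p a) = P a (L p a)" "Q b (L p b) = P b (L p b)" "Q c (L p c) = P c (L p c)"
    using B(2,7-9) B1(2) B2(2) by (auto simp: Q_def P1_def upd_eq)
  have Qc: "L Q c = lam c" using hub_brick[OF h Q] ab by (simp add: ly)
  have Qa: "L Q a = L p a" using hub_brick[OF hub_rot[OF h] Q] ab by (simp add: ly)
  have Qb: "L Q b = L p b" using hub_brick[OF hub_rot[OF hub_rot[OF h]] Q] ab by (simp add: ly)
  have "L P1 = L Q"
  proof (rule slab_reset[OF _ Q _ B(5)])
    show "slab {a,b,c} lam kap P1" using P by (auto simp: slab_def P1_def)
    have "P1 c (lam c) = Q c (lam c)" "P1 a = P a" "P1 b = P b" using B(7-9) by (auto simp: Q_def P1_def)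
    then show "P1 j (L Q j) = Q j (L Q j)" if "j \<in> {a,b,c}" for j
      using that by (auto simp: Qa Qb Qc ly)
  qed
  then have "L P1 c = lam c" using Qc by simp
  then show ?thesis by (simp add: P1_def)
qed

text \<open>
  If none of the three coordinates is in its exceptional position, then resetting the layers of the
  letters of the brick leads into the brick, where all three main letters are read and the reset
  layers are not.
\<close>

lemma hub_slab_centre:
  assumes h: "hub a b c lam kap p" and P: "slab {a,b,c} lam kap P"
    and all: "\<not> (P a (L p a) \<in> still p a \<and> P b (L p b) \<notin> still p b)"
      "\<not> (P b (L p b) \<in> still p b \<and> P c (L p c) \<notin> still p c)"
      "\<not> (P c (L p c) \<in> still p c \<and> P a (L p a) \<notin> still p a)"
  shows "L P c = L p c"
proof -
  note B = hub_basics[OF h]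
  note B1 = hub_basics[OF hub_rot[OF h]]
  note B2 = hub_basics[OF hub_rot[OF hub_rot[OF h]]]
  define Q where "Q = upd (upd (upd P c (lam c) (kap c)) a (lam a) (kap a)) b (lam b) (kap b)"
  have Q: "brick lam kap Q" using P B(7-9) by (auto simp: brick_def Q_def upd_eq slab_def)
  have ly: "Q a (L p a) = P a (L p a)" "Q b (L p b) = P b (L p b)" "Q c (L p c) = P c (L p c)"
    using B(2,7-9) B1(2) B2(2) by (auto simp: Q_def upd_eq)
  have Qc: "L Q c = L p c" using hub_brick[OF h Q] all by (auto simp add: ly)
  have Qa: "L Q a = L p a" using hub_brick[OF hub_rot[OF h] Q] all by (auto simp add: ly)
  have Qb: "L Q b = L p b" using hub_brick[OF hub_rot[OF hub_rot[OF h]] Q] all by (auto simp add: ly)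
  have "L P = L Q"
    by (rule slab_reset[OF P Q _ B(5)]) (auto simp: Qa Qb Qc ly)
  then show ?thesis using Qc by simp
qed

text \<open>
  By the line property the layer of the letter of c may be chosen freely. This brings the point
  into one of the two preceding situations, unless a has moved and b has not. In that case, if c did
  not read its main letter, then both choices would give the same cube. But one choice makes b read
  lam b and the other its main letter.
\<close>

lemma hub_slab:
  assumes h: "hub a b c lam kap p" and P: "slab {a,b,c} lam kap P"
  shows "L P c = (if P a (L p a) \<in> still p a \<and> P b (L p b) \<notin> still p b then lam c else L p c)"
proof -
  note B = hub_basics[OF h]
  note B1 = hub_basics[OF hub_rot[OF h]]
  note B2 = hub_basics[OF hub_rot[OF hub_rot[OF h]]]
  have cA: "arrow p c a" using h by (simp add: hub_def)
  obtain t where t: "t \<in> still p c" by (auto simp: still_def upd_def intro: that[of "p c (L p c)"])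
  obtain u where u: "u \<notin> still p c" using arrow_not_still[OF cA] by blast
  define Pt where "Pt = upd P c (L p c) t"
  define Pu where "Pu = upd P c (L p c) u"
  have sl: "slab {a,b,c} lam kap Pt" "slab {a,b,c} lam kap Pu" using P by (auto simp: slab_def Pt_def Pu_def)
  have lt: "Pt a (L p a) = P a (L p a)" "Pt b (L p b) = P b (L p b)" "Pt c (L p c) = t"
    "Pu a (L p a) = P a (L p a)" "Pu b (L p b) = P b (L p b)" "Pu c (L p c) = u"
    using B(7-9) by (auto simp: Pt_def Pu_def)
  have ln: "L Pt c = L P c" "L Pu c = L P c" by (auto simp: Pt_def Pu_def)
  consider (1) "P a (L p a) \<in> still p a" "P b (L p b) \<notin> still p b" | (2) "P a (L p a) \<in> still p a" "P b (L p b) \<in> still p b"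
    | (3) "P a (L p a) \<notin> still p a" "P b (L p b) \<notin> still p b" | (4) "P a (L p a) \<notin> still p a" "P b (L p b) \<in> still p b" by blast
  then show ?thesis
  proof cases
    case 1 then show ?thesis using hub_slab_exceptional[OF h P] by simp
  next
    case 2 then show ?thesis using hub_slab_centre[OF h sl(1)] t by (simp add: lt ln)
  next
    case 3 then show ?thesis using hub_slab_centre[OF h sl(2)] u by (simp add: lt ln)
  next
    case 4
    have "L P c = L p c"
    proof (rule ccontr)
      assume n: "L P c \<noteq> L p c"
      then have eq: "L Pt = L P" "L Pu = L P" unfolding Pt_def Pu_def by (auto intro!: upd_unread)
      have h2: "hub c a b lam kap p" using h hub_rot by blast
      have s2: "slab {c,a,b} lam kap Pt" "slab {c,a,b} lam kap Pu" using sl by (simp_all add: insert_commute)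
      have "L Pt b = lam b" using hub_slab_exceptional[OF h2 s2(1)] t 4 by (simp add: lt)
      moreover have "L Pu b = L p b"
      proof -
        \<comment> \<open>in direction b the layer is free as well; moving b too leaves no coordinate exceptional\<close>
        obtain w where w: "w \<notin> still p b" using h arrow_not_still[of p b c] by (auto simp: hub_def)
        define Pw where "Pw = upd Pu b (L p b) w"
        have sw: "slab {c,a,b} lam kap Pw" using s2 by (auto simp: slab_def Pw_def)
        have lw: "Pw a (L p a) = P a (L p a)" "Pw b (L p b) = w" "Pw c (L p c) = u"
          using lt B(7-9) by (auto simp: Pw_def)
        have "L Pw b = L p b" using hub_slab_centre[OF h2 sw] 4 u w by (simp add: lw)
        then show ?thesis by (simp add: Pw_def)
      qed
      ultimately show False using B1(2) eq by simp
    qed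
    then show ?thesis using 4 by simp
  qed
qed

text \<open>
  Each of the three coordinates reads its main letter f, except in one product region: lam c is read
  when the layer in a lies in S a and that in b lies outside S b, and cyclically. The regions are
  the three pairwise disjoint rods around a corner.
\<close>

definition corner_at :: "'i \<Rightarrow> 'i \<Rightarrow> 'i \<Rightarrow> ('i \<Rightarrow> 'a) \<Rightarrow> ('i \<Rightarrow> 'a) \<Rightarrow> ('i \<Rightarrow> 'b set) \<Rightarrow> ('i \<Rightarrow> 'a \<Rightarrow> 'b) \<Rightarrow> bool" where
  "corner_at a b c lam f S P \<longleftrightarrow>
     L P a = (if P b (f b) \<in> S b \<and> P c (f c) \<notin> S c then lam a else f a) \<and>
     L P b = (if P c (f c) \<in> S c \<and> P a (f a) \<notin> S a then lam b else f b) \<and>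
     L P c = (if P a (f a) \<in> S a \<and> P b (f b) \<notin> S b then lam c else f c)"

definition corner where
  "corner a b c lam kap f S \<longleftrightarrow> cut_brick {a,b,c} lam kap \<and> a \<noteq> b \<and> b \<noteq> c \<and> a \<noteq> c \<and> {a,b,c} \<subseteq> A \<and>
    (\<forall>j\<in>{a,b,c}. f j \<noteq> lam j \<and> S j \<noteq> {} \<and> S j \<noteq> UNIV) \<and>
    (\<forall>P. slab {a,b,c} lam kap P \<longrightarrow> corner_at a b c lam f S P)"

lemma corner_rot: "corner a b c lam kap f S \<Longrightarrow> corner b c a lam kap f S"
  by (auto simp: corner_def corner_at_def insert_commute)

lemma hub_corner:
  assumes h: "hub a b c lam kap p"
  shows "corner a b c lam kap (L p) (still p)"
proof -
  note B = hub_basics[OF h]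
  note B1 = hub_basics[OF hub_rot[OF h]]
  note B2 = hub_basics[OF hub_rot[OF hub_rot[OF h]]]
  have st: "p j (L p j) \<in> still p j" for j by (simp add: still_def upd_def)
  have "arrow p a b" "arrow p b c" "arrow p c a" using h by (auto simp: hub_def)
  from this[THEN arrow_not_still] have pr: "still p j \<noteq> {} \<and> still p j \<noteq> UNIV" if "j \<in> {a,b,c}" for j
    using that st[of j] by auto
  have "corner_at a b c lam (L p) (still p) P" if P: "slab {a,b,c} lam kap P" for P
  proof -
    have P1: "slab {b,c,a} lam kap P" and P2: "slab {c,a,b} lam kap P" using P by (simp_all add: insert_commute)
    show ?thesis unfolding corner_at_def
      using hub_slab[OF h P] hub_slab[OF hub_rot[OF h] P1] hub_slab[OF hub_rot[OF hub_rot[OF h]] P2] by simp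
  qed
  then show ?thesis unfolding corner_def using B(1,2,5,7-9) B1(1,2) B2(1,2) pr by auto
qed

text \<open>
  Reversing the orientation exchanges the two sides of each layer set.
\<close>

lemma corner_swap:
  assumes "corner a c b lam kap f S" shows "corner a b c lam kap f (\<lambda>j. - S j)"
proof -
  have "{a,c,b} = {a,b,c}" by auto
  then show ?thesis using assms unfolding corner_def corner_at_def by auto
qed

lemma corner_ex:
  assumes c: "cut_brick {a,b,c} lam kap" and d: "a \<noteq> b" "b \<noteq> c" "a \<noteq> c"
  obtains f S where "corner a b c lam kap f S"
  using hub_ex[OF c d] hub_corner corner_swap by metis

text \<open>
  The part of a rod inside the brick is a cube of the tiling: two coordinates have
  main letters and all other letters are those of the brick.
\<close>

lemma corner_exceptional_word:
  assumes k: "corner a b c lam kap f S" and p: "p \<in> S a" and q: "q \<notin> S b"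
    and P: "brick (lam(a := f a, b := f b)) (kap(a := p, b := q)) P"
  shows "L P i = (lam(a := f a, b := f b)) i \<or> i \<notin> A"
proof -
  have K: "cut_brick {a,b,c} lam kap" "a \<noteq> b" "b \<noteq> c" "a \<noteq> c" "{a,b,c} \<subseteq> A" "f a \<noteq> lam a" "f b \<noteq> lam b"
    using k by (auto simp: corner_def)
  define Q where "Q = upd (upd P a (lam a) (kap a)) b (lam b) (kap b)"
  have Q: "brick lam kap Q" unfolding brick_def
  proof
    fix i assume "i \<in> A"
    then show "Q i (lam i) = kap i" using P K(2) by (auto simp: Q_def brick_def upd_eq split: if_splits)
  qed
  have sl: "slab {a,b,c} lam kap Q" using Q by (auto simp: slab_def brick_def)
  have ly: "Q a (f a) = p" "Q b (f b) = q"
    using P K by (auto simp: Q_def brick_def upd_eq dest: bspec[of A _ a] bspec[of A _ b])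
  have LQ: "L Q a = f a" "L Q b = f b" "L Q c = lam c"
    using k sl p q by (auto simp: corner_def corner_at_def ly)
  have Lo: "L Q i = lam i" if "i \<in> A" "i \<notin> {a,b,c}" for i
    using cut_brickD(1)[OF K(1) Q] that by (auto simp: cut_def)
  have "L P = L Q"
  proof (rule determined)
    fix i assume i: "i \<in> A"
    show "P i (L Q i) = Q i (L Q i)"
    proof (cases "i = a \<or> i = b")
      case True then show ?thesis using LQ K by (auto simp: Q_def upd_eq)
    qed (auto simp: Q_def)
  qed
  then show ?thesis using LQ Lo[of i] K by auto
qed

text \<open>
  That cube has no column in direction c, so for some layer l of lam c its neighbour brick is not a cube
  of the tiling. On this brick the corner fixes the letters in a, b and c.
\<close>

lemma corner_exceptional_brick:
  assumes k: "corner a b c lam kap f S" and p: "p \<in> S a" and q: "q \<notin> S b"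
  obtains l where "cut_brick (A - {a,b,c}) (lam(a := f a, b := f b)) (kap(a := p, b := q, c := l))"
proof -
  have K: "cut_brick {a,b,c} lam kap" "a \<noteq> b" "b \<noteq> c" "a \<noteq> c" "{a,b,c} \<subseteq> A" "f a \<noteq> lam a" "f b \<noteq> lam b"
    using k by (auto simp: corner_def)
  define lam' where "lam' = lam(a := f a, b := f b)"
  define P where "P = (\<lambda>i (_::'a). (kap(a := p, b := q)) i)"
  have P: "brick lam' (kap(a := p, b := q)) P" by (simp add: brick_def P_def)
  have LP: "L P i = lam' i" if "i \<in> A" for i using corner_exceptional_word[OF k p q P[unfolded lam'_def], of i] that lam'_def by auto
  obtain l where l: "L (upd P c (L P c) l) \<noteq> L P" using no_column[of c P] K(5) by auto
  define kap' where "kap' = kap(a := p, b := q, c := l)"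
  have "cut_brick (A - {a,b,c}) lam' kap'"
  proof (rule cut_brickI)
    fix z assume z: "brick lam' kap' z"
    have sl: "slab {a,b,c} lam kap z" unfolding slab_def
    proof
      fix i assume i: "i \<in> A - {a,b,c}"
      then have "z i (lam' i) = kap' i" using z by (simp add: brick_def)
      then show "z i (lam i) = kap i" using i by (simp add: lam'_def kap'_def)
    qed
    have ly: "z a (f a) = p" "z b (f b) = q"
      using z K by (auto simp: lam'_def kap'_def brick_def dest: bspec[of A _ a] bspec[of A _ b])
    have "L z a = f a" "L z b = f b" "L z c = lam c"
      using k sl p q by (auto simp: corner_def corner_at_def ly)
    then show "cut lam' z \<subseteq> A - {a,b,c}" using K by (auto simp: cut_def lam'_def)
  next
    show "brick lam' kap' (upd P c (L P c) l)"
      using K LP[of c] by (auto simp: brick_def kap'_def P_def upd_eq)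
    show "cut lam' (upd P c (L P c) l) \<noteq> {}"
    proof
      assume "cut lam' (upd P c (L P c) l) = {}"
      then have "L (upd P c (L P c) l) i = L P i" for i
        using outside LP[of i] by (cases "i \<in> A") (auto simp: cut_def)
      then show False using l by blast
    qed
  qed
  then show ?thesis using that by (simp add: lam'_def kap'_def)
qed

text \<open>
  In a section that carries two corners, first choose the layer in y outside S y and the layer in z inside
  S' z. This makes both corners read their main letter in x, so these agree. Then move to
  the rod of the first corner: both read a letter other than the main one.
\<close>

lemma corners_share_letter:
  assumes k: "corner x y z lam kap f S" and k': "corner x y z lam' kap' f' S'"
    and P: "\<And>i. i \<in> A - {x,y,z} \<Longrightarrow> P i (lam i) = kap i" "\<And>i. i \<in> A - {x,y,z} \<Longrightarrow> P i (lam' i) = kap' i"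
  shows "lam x = lam' x"
proof -
  have K: "y \<noteq> z" "x \<noteq> y" "x \<noteq> z" "f x \<noteq> lam x" "S y \<noteq> {}" "S y \<noteq> UNIV" "S z \<noteq> UNIV" "S' z \<noteq> {}"
    using k k' by (auto simp: corner_def)
  have val: "L Q x = (if Q y (f y) \<in> S y \<and> Q z (f z) \<notin> S z then lam x else f x)"
    "L Q x = (if Q y (f' y) \<in> S' y \<and> Q z (f' z) \<notin> S' z then lam' x else f' x)"
    if Q: "Q = P(y := u, z := v)" for Q u v
  proof -
    have "slab {x,y,z} lam kap Q" "slab {x,y,z} lam' kap' Q" using P Q by (auto simp: slab_def)
    then have "corner_at x y z lam f S Q" "corner_at x y z lam' f' S' Q" using k k' by (auto simp: corner_def)
    then show "L Q x = (if Q y (f y) \<in> S y \<and> Q z (f z) \<notin> S z then lam x else f x)"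
      "L Q x = (if Q y (f' y) \<in> S' y \<and> Q z (f' z) \<notin> S' z then lam' x else f' x)"
      by (simp_all add: corner_at_def)
  qed
  obtain y0 z0 where yz: "y0 \<notin> S y" "z0 \<in> S' z" using K by blast
  have ff: "f x = f' x" using val[OF refl, of "\<lambda>_. y0" "\<lambda>_. z0"] yz K(1) by simp
  obtain y1 z1 where yz: "y1 \<in> S y" "z1 \<notin> S z" using K by blast
  show ?thesis using val[OF refl, of "\<lambda>_. y1" "\<lambda>_. z1"] yz K(1,4) ff by (auto split: if_splits)
qed

text \<open>
  Two bricks with the same letters in a, b, c but different letters in x. If their corners differed in
  the main letter or in the layer set of a, then a rod of the first and a rod of the second could be
  chosen that meet: the first rod leaves S a, the second lies in S' a, and in b and c one rod reads a main
  letter and the other the letter of the brick. The bricks of \<open>corner_exceptional_brick\<close>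
  in these rods have corners in the directions x, y, z in a common section, which
  \<open>corners_share_letter\<close> excludes.
\<close>

lemma corner_main_subset:
  assumes k: "corner a b c lam kap f S" and k': "corner a b c lam' kap' f' S'"
    and same: "\<And>j. j \<in> {a,b,c} \<Longrightarrow> lam' j = lam j"
    and O: "A - {a,b,c} = {x,y,z}" "x \<noteq> y" "y \<noteq> z" "x \<noteq> z" and ne: "lam x \<noteq> lam' x"
  shows "f a = f' a \<and> S' a \<subseteq> S a"
proof (rule ccontr)
  assume n: "\<not> ?thesis"
  have K: "a \<noteq> b" "b \<noteq> c" "a \<noteq> c" "{a,b,c} \<subseteq> A" "f a \<noteq> lam a" "f b \<noteq> lam b" "f c \<noteq> lam c" "S a \<noteq> UNIV" "S c \<noteq> {}"
    using k by (auto simp: corner_def)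
  have K': "f' a \<noteq> lam a" "f' b \<noteq> lam b" "f' c \<noteq> lam c" "S' a \<noteq> {}" "S' b \<noteq> UNIV"
    using k' same by (auto simp: corner_def)
  obtain a1 a2 where a1: "a1 \<notin> S a" and a2: "a2 \<in> S' a" and aa: "f a = f' a \<Longrightarrow> a1 = a2"
  proof (cases "f a = f' a")
    case True
    then obtain a1 where "a1 \<in> S' a" "a1 \<notin> S a" using n by blast
    then show ?thesis using that by blast
  next
    case False then show ?thesis using that K(8) K'(4) by blast
  qed
  obtain c1 where c1: "c1 \<in> S c" using K(9) by blast
  obtain b2 where b2: "b2 \<notin> S' b" using K'(5) by blast
  have x: "x \<notin> {a,b,c}" using O by auto
  obtain l where "cut_brick (A - {c,a,b}) (lam(c := f c, a := f a)) (kap(c := c1, a := a1, b := l))"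
    using corner_exceptional_brick[OF corner_rot[OF corner_rot[OF k]] c1 a1] by blast
  then have "cut_brick {x,y,z} (lam(c := f c, a := f a)) (kap(c := c1, a := a1, b := l))"
    using O(1) by (simp add: insert_commute)
  then obtain g T where g: "corner x y z (lam(c := f c, a := f a)) (kap(c := c1, a := a1, b := l)) g T"
    using corner_ex O by metis
  obtain l' where "cut_brick (A - {a,b,c}) (lam'(a := f' a, b := f' b)) (kap'(a := a2, b := b2, c := l'))"
    using corner_exceptional_brick[OF k' a2 b2] by blast
  then have "cut_brick {x,y,z} (lam'(a := f' a, b := f' b)) (kap'(a := a2, b := b2, c := l'))"
    using O(1) by simp
  then obtain g' T' where g': "corner x y z (lam'(a := f' a, b := f' b)) (kap'(a := a2, b := b2, c := l')) g' T'"
    using corner_ex O by metis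
  define P where "P = (\<lambda>i m. if i = a then (if m = f a then a1 else a2) else
    if i = b then (if m = lam b then l else b2) else (if m = f c then c1 else l'))"
  have J: "A - {x,y,z} = {a,b,c}" using O K(4) by auto
  have "(lam(c := f c, a := f a)) x = (lam'(a := f' a, b := f' b)) x"
    by (rule corners_share_letter[OF g g', of P]) (use J K K' aa same in \<open>auto simp: P_def\<close>)
  then show False using x ne by simp
qed

section \<open>Six coordinates: no brick is cut in only three\<close>

text \<open>
  A rod of the corner on a, b, c gives a brick that is cut in x, y, z only. Its corner has three rods, and
  these give three bricks cut in a, b, c only; in two of the coordinates x, y, z each of them has main
  letters, in the third the letter of the first brick. By \<open>corner_main_subset\<close>
  their corners on a, b, c agree in coordinate a. So there is a layer r of the common main letter for which
  all three read a main letter in c. Then the layer of lam0 c is not read and can be set to that of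
  the first brick.
\<close>

lemma no_cut_brick_3:
  assumes A6: "card A = 6" and c0: "cut_brick {a,b,c} lam0 kap0" and J: "{a,b,c} \<subseteq> A" "a \<noteq> b" "b \<noteq> c" "a \<noteq> c"
  shows False
proof -
  have "card (A - {a,b,c}) = 3" using J A6 by (simp add: card_Diff_subset)
  then obtain x y z where O: "A - {a,b,c} = {x,y,z}" "x \<noteq> y" "y \<noteq> z" "x \<noteq> z" by (auto simp: card_3_iff)
  have OJ: "x \<notin> {a,b,c}" "y \<notin> {a,b,c}" "z \<notin> {a,b,c}" using O(1) by auto
  have AO: "A - {x,y,z} = {a,b,c}" using O(1) J(1) by auto
  have Aeq: "A = {a,b,c,x,y,z}" using O(1) J(1) by auto
  obtain f0 S0 where k0: "corner a b c lam0 kap0 f0 S0" using corner_ex[OF c0 J(2-4)] .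
  have K0: "f0 a \<noteq> lam0 a" "f0 b \<noteq> lam0 b" "S0 a \<noteq> {}" "S0 b \<noteq> UNIV" using k0 by (auto simp: corner_def)
  obtain p q where p: "p \<in> S0 a" and q: "q \<notin> S0 b" using K0 by blast
  define lam1 where "lam1 = lam0(a := f0 a, b := f0 b)"
  obtain l where "cut_brick (A - {a,b,c}) lam1 (kap0(a := p, b := q, c := l))"
    using corner_exceptional_brick[OF k0 p q] lam1_def by auto
  define kap1 where "kap1 = kap0(a := p, b := q, c := l)"
  have "cut_brick {x,y,z} lam1 kap1" using \<open>cut_brick (A - {a,b,c}) lam1 _\<close> O(1) kap1_def by simp
  then obtain g T where kg: "corner x y z lam1 kap1 g T" using corner_ex O by metis
  have Kg: "\<forall>o'\<in>{x,y,z}. g o' \<noteq> lam1 o' \<and> T o' \<noteq> {} \<and> T o' \<noteq> UNIV" using kg by (auto simp: corner_def)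
  then have gn: "g x \<noteq> lam1 x" "g y \<noteq> lam1 y" "g z \<noteq> lam1 z" by auto
  obtain px py pz where pT: "px \<in> T x" "py \<in> T y" "pz \<in> T z" using Kg by blast
  obtain qx qy qz where qT: "qx \<notin> T x" "qy \<notin> T y" "qz \<notin> T z" using Kg by blast
  \<comment> \<open>one brick for each rod of the corner on x, y, z; the name tells the exceptional coordinate\<close>
  obtain kx where kx: "cut_brick (A - {y,z,x}) (lam1(y := g y, z := g z)) (kap1(y := py, z := qz, x := kx))"
    using corner_exceptional_brick[OF corner_rot[OF kg] pT(2) qT(3)] .
  obtain ky where ky: "cut_brick (A - {z,x,y}) (lam1(z := g z, x := g x)) (kap1(z := pz, x := qx, y := ky))"
    using corner_exceptional_brick[OF corner_rot[OF corner_rot[OF kg]] pT(3) qT(1)] .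
  obtain kz where kz: "cut_brick (A - {x,y,z}) (lam1(x := g x, y := g y)) (kap1(x := px, y := qy, z := kz))"
    using corner_exceptional_brick[OF kg pT(1) qT(2)] .
  define lx ly lz where l: "lx = lam1(y := g y, z := g z)" "ly = lam1(z := g z, x := g x)" "lz = lam1(x := g x, y := g y)"
  define mx my mz where m: "mx = kap1(y := py, z := qz, x := kx)" "my = kap1(z := pz, x := qx, y := ky)" "mz = kap1(x := px, y := qy, z := kz)"
  have sets: "A - {y,z,x} = {a,b,c}" "A - {z,x,y} = {a,b,c}" using AO by (auto simp: insert_commute)
  have cx: "cut_brick {a,b,c} lx mx" and cy: "cut_brick {a,b,c} ly my" and cz: "cut_brick {a,b,c} lz mz"
    using kx ky kz unfolding sets AO l m by auto
  obtain fx Sx where Kx: "corner a b c lx mx fx Sx" using corner_ex[OF cx J(2-4)] .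
  obtain fy Sy where Ky: "corner a b c ly my fy Sy" using corner_ex[OF cy J(2-4)] .
  obtain fz Sz where Kz: "corner a b c lz mz fz Sz" using corner_ex[OF cz J(2-4)] .
  have lJ: "lx j = lam1 j" "ly j = lam1 j" "lz j = lam1 j" "mx j = kap1 j" "my j = kap1 j" "mz j = kap1 j"
    if "j \<in> {a,b,c}" for j using that OJ by (auto simp: l m)
  have lv: "lx x = lam1 x" "lx y = g y" "lx z = g z" "ly x = g x" "ly y = lam1 y" "ly z = g z"
    "lz x = g x" "lz y = g y" "lz z = lam1 z" "mx x = kx" "mx y = py" "mx z = qz" "my x = qx" "my y = ky" "my z = pz"
    "mz x = px" "mz y = qy" "mz z = kz" using O by (auto simp: l m)
  have O': "A - {a,b,c} = {y,z,x}" using O(1) by auto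
  have xy: "fx a = fy a \<and> Sy a \<subseteq> Sx a" by (rule corner_main_subset[OF Kx Ky _ O]) (use lJ lv gn in auto)
  have yx: "fy a = fx a \<and> Sx a \<subseteq> Sy a" by (rule corner_main_subset[OF Ky Kx _ O]) (use lJ lv gn in auto)
  have xz: "fx a = fz a \<and> Sz a \<subseteq> Sx a" by (rule corner_main_subset[OF Kx Kz _ O]) (use lJ lv gn in auto)
  have zx: "fz a = fx a \<and> Sx a \<subseteq> Sz a" by (rule corner_main_subset[OF Kz Kx _ O]) (use lJ lv gn in auto)
  define e where "e = fx a"
  have fe: "fx a = e" "fy a = e" "fz a = e" using xy xz by (auto simp: e_def)
  have Sa: "Sy a = Sx a" "Sz a = Sx a" using xy yx xz zx by blast+
  have Kx': "fx a \<noteq> lx a" "Sx a \<noteq> UNIV" using Kx by (auto simp: corner_def)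
  have "lx a = f0 a" using lJ(1)[of a] J(2) by (simp add: lam1_def)
  then have ene: "e \<noteq> f0 a" using Kx'(1) by (simp add: e_def)
  obtain r where r: "r \<notin> Sx a" using Kx' by blast
  \<comment> \<open>In a, b, c the point N lies in the rod of the first corner, with layer r for the
    main letter of a common to the three bricks. In x, y, z it lies
    on none of the three bricks, but it is one move away from each of them.\<close>
  define N where "N = (\<lambda>i m. if i = a then (if m = f0 a then p else r) else if i = b then q else if i = c then kap0 c
    else if i = x then (if m = g x then px else kx) else if i = y then (if m = g y then py else ky)
    else (if m = g z then pz else kz))"
  have Nv: "N a = (\<lambda>m. if m = f0 a then p else r)" "N b = (\<lambda>_. q)" "N c = (\<lambda>_. kap0 c)"
    "N x = (\<lambda>m. if m = g x then px else kx)" "N y = (\<lambda>m. if m = g y then py else ky)" "N z = (\<lambda>m. if m = g z then pz else kz)"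
    using OJ O(2-4) J(2-4) by (simp_all add: N_def)
  \<comment> \<open>A point in one of the three sections that agrees with N in a, b, c has the letters of that brick
    in x, y, z: its letter in c is the main one, so resetting the layer of the other leads into the brick.\<close>
  have key: "L M i = lam' i" if K: "corner a b c lam' kap' f' S'" and f': "f' a = e" "r \<notin> S' a"
    and sm: "\<And>j. j \<in> {a,b,c} \<Longrightarrow> lam' j = lam1 j" "\<And>j. j \<in> {a,b,c} \<Longrightarrow> kap' j = kap1 j" "\<And>j. j \<in> {a,b,c} \<Longrightarrow> M j = N j"
    and sl: "slab {a,b,c} lam' kap' M" and i: "i \<in> {x,y,z}" for M lam' kap' f' S' i
  proof -
    have Kk: "cut_brick {a,b,c} lam' kap'" "f' c \<noteq> lam' c" "L M c = (if M a (f' a) \<in> S' a \<and> M b (f' b) \<notin> S' b then lam' c else f' c)"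
      using K sl by (auto simp: corner_def corner_at_def)
    have "M a e = r" using sm(3)[of a] ene by (simp add: Nv)
    then have Mc: "L M c \<noteq> lam' c" using Kk f' by simp
    define Q where "Q = upd M c (lam' c) (kap' c)"
    have Q: "brick lam' kap' Q" unfolding brick_def
    proof
      fix j assume j: "j \<in> A"
      show "Q j (lam' j) = kap' j"
      proof (cases "j \<in> {a,b,c}")
        case True then show ?thesis using sm J by (auto simp: Q_def upd_eq Nv lam1_def kap1_def)
      next
        case False then show ?thesis using sl j by (simp add: Q_def slab_def)
      qed
    qed
    have "L Q = L M" unfolding Q_def using Mc by (intro upd_unread) simp
    moreover have "i \<notin> cut lam' Q" using cut_brickD(1)[OF Kk(1) Q] i OJ by auto
    moreover have "i \<in> A" using i O(1) by blast
    ultimately show ?thesis by (simp add: cut_def)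
  qed
  have slabI: "slab {a,b,c} lam' kap' M" if "M x (lam' x) = kap' x" "M y (lam' y) = kap' y" "M z (lam' z) = kap' z" for M lam' kap'
    using that O(1) by (simp add: slab_def)
  \<comment> \<open>Each of these three moves stays on a line of N, so N reads the main letters in x, y, z.\<close>
  have "L (upd N x (g x) qx) x = ly x"
    by (rule key[OF Ky fe(2)]) (use r Sa lJ OJ O gn in \<open>auto intro!: slabI simp: lv upd_eq Nv\<close>)
  then have Nx: "L N x = g x" by (simp add: lv)
  have "L (upd N y (g y) qy) y = lz y"
    by (rule key[OF Kz fe(3)]) (use r Sa lJ OJ O gn in \<open>auto intro!: slabI simp: lv upd_eq Nv\<close>)
  then have Ny: "L N y = g y" by (simp add: lv)
  have "L (upd N z (g z) qz) z = lx z"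
    by (rule key[OF Kx fe(1)]) (use r Sa lJ OJ O gn in \<open>auto intro!: slabI simp: lv upd_eq Nv\<close>)
  then have Nz: "L N z = g z" by (simp add: lv)
  \<comment> \<open>Since the other letters are not read there, their layers can be set to those of the first brick.
    This point lies in the rod of the first corner.\<close>
  define M where "M = upd (upd (upd N x (lam1 x) (kap0 x)) y (lam1 y) (kap0 y)) z (lam1 z) (kap0 z)"
  have "L M = L N"
    by (rule determined) (use Nx Ny Nz gn O(2-4) in \<open>auto simp: M_def upd_eq\<close>)
  moreover have "L M x = (lam0(a := f0 a, b := f0 b)) x \<or> x \<notin> A"
  proof (rule corner_exceptional_word[OF k0 p q])
    show "brick (lam0(a := f0 a, b := f0 b)) (kap0(a := p, b := q)) M"
      unfolding brick_def
    proof
      fix i assume "i \<in> A"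
      then have "i \<in> {a,b,c,x,y,z}" using Aeq by blast
      then show "M i ((lam0(a := f0 a, b := f0 b)) i) = (kap0(a := p, b := q)) i"
        using OJ J(2-4) O(2-4) by (auto simp: M_def upd_eq Nv lam1_def)
    qed
  qed
  moreover have "x \<in> A" using O(1) by blast
  ultimately show False using Nx gn(1) by (simp add: lam1_def)
qed

lemma lone_out_le_6:
  assumes A: "card A \<le> 6" and a: "a \<in> A" and lone: "\<And>b. arrow z a b \<Longrightarrow> b = t"
  shows False
proof -
  consider "card A \<le> 4" | "card A = 5" | "card A = 6" using A by linarith
  then show False
  proof cases
    case 1 then show False using lone_out_small[OF _ a lone] by blast
  next
    case 2 then show False using lone_out_5[OF _ a lone] by blast
  next
    case 3
    have "rigid 3"
      unfolding rigid_def
    proof (intro allI impI notI)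
      fix S lam kap assume S: "finite (S :: 'i set)" "card S \<le> 3" and c: "cut_brick S lam kap"
      have c': "cut_brick (S \<inter> A) lam kap" using c by (auto simp: cut_brick_def cut_def)
      have "\<not> card (S \<inter> A) \<le> 2" using rigid_2 c' finite_A unfolding rigid_def by blast
      moreover have "card (S \<inter> A) \<le> card S" using S(1) by (intro card_mono) auto
      ultimately have "card (S \<inter> A) = 3" using S(2) by linarith
      then obtain a b c where abc: "S \<inter> A = {a,b,c}" "a \<noteq> b" "b \<noteq> c" "a \<noteq> c" by (auto simp: card_3_iff)
      show False by (rule no_cut_brick_3[OF 3 c'[unfolded abc(1)]]) (use abc in auto)
    qed
    then show False by (rule lone_out_6[OF _ 3 a lone])
  qed
qed

end

section \<open>Induction on the number of coordinates\<close>

text \<open>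
  Fixing coordinate i and forgetting its letter gives a lettering on the other coordinates, except
  that it has a column. Moves in the direction of this column change no letter other than that of i.
\<close>

lemma (in lettering) slice_lone_out:
  assumes i: "i \<in> A" and none: "\<And>L' :: ('i \<Rightarrow> 'a \<Rightarrow> 'b) \<Rightarrow> 'i \<Rightarrow> 'a. \<not> lettering (A - {i}) L'"
  obtains z m where "m \<in> A" "\<And>b. arrow z m b \<Longrightarrow> b = i"
proof -
  define w :: "'a \<Rightarrow> 'b" where "w = undefined"
  define L' where "L' = (\<lambda>z j. if j \<in> A - {i} then L (z(i := w)) j else undefined)"
  have cl: "L' z' = L' z" if "\<And>j. j \<in> A - {i} \<Longrightarrow> z' j (L' z j) = z j (L' z j)" for z z'
  proof -
    have "L (z'(i:=w)) = L (z(i:=w))" by (rule determined) (use that in \<open>auto simp: L'_def\<close>)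
    then show ?thesis by (auto simp: L'_def)
  qed
  have "\<exists>z. \<exists>m\<in>A - {i}. \<forall>k. L' (upd z m (L' z m) k) = L' z"
  proof (rule ccontr)
    assume nc: "\<not> ?thesis"
    have "lettering (A - {i}) L'"
    proof
      show "finite (A - {i})" using finite_A by simp
      show "L' z' = L' z" if "\<And>j. j \<in> A - {i} \<Longrightarrow> z' j (L' z j) = z j (L' z j)" for z z'
        using that by (rule cl)
      show "L' z j = undefined" if "j \<notin> A - {i}" for z j using that by (auto simp: L'_def)
      show "\<exists>k. L' (upd z j (L' z j) k) \<noteq> L' z" if "j \<in> A - {i}" for z j using nc that by blast
    qed
    then show False using none by blast
  qed
  then obtain z m where m: "m \<in> A - {i}" and col: "\<And>k. L' (upd z m (L' z m) k) = L' z" by blast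
  have "b = i" if ar: "arrow (z(i:=w)) m b" for b
  proof (rule ccontr)
    assume "b \<noteq> i"
    obtain k where "L (upd (z(i:=w)) m (L (z(i:=w)) m) k) b \<noteq> L (z(i:=w)) b" using ar by (auto simp: arrow_def)
    moreover have "upd (z(i:=w)) m (L (z(i:=w)) m) k = (upd z m (L' z m) k)(i:=w)"
      using m by (auto simp: upd_def L'_def fun_eq_iff)
    moreover have "L' (upd z m (L' z m) k) b = L' z b" using col by simp
    ultimately show False using \<open>b \<noteq> i\<close> arrow_in[OF ar] by (auto simp: L'_def)
  qed
  then show ?thesis using that m by blast
qed

lemma no_lettering_le_6:
  fixes L :: "('i \<Rightarrow> 'a \<Rightarrow> 'b) \<Rightarrow> 'i \<Rightarrow> 'a"
  assumes "lettering A L" and "A \<noteq> {}" and "card A \<le> 6"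
  shows False
  using assms
proof (induction "card A" arbitrary: A L rule: less_induct)
  case less
  interpret lettering A L by fact
  obtain i where i: "i \<in> A" using less.prems(2) by blast
  show False
  proof (cases "A = {i}")
    case True
    obtain b where b: "arrow undefined i b" using arrow_ex[OF i] by blast
    show False using arrow_in[OF b] arrow_ne[OF b] True by simp
  next
    case False
    have cs: "card (A - {i}) < card A" using finite_A i by (rule card_Diff1_less)
    have "\<not> lettering (A - {i}) L'" for L' :: "('i \<Rightarrow> 'a \<Rightarrow> 'b) \<Rightarrow> 'i \<Rightarrow> 'a"
    proof
      assume "lettering (A - {i}) L'"
      then show False using less.hyps[OF cs] False i less.prems(3) cs by fastforce
    qed
    then obtain z m where "m \<in> A" "\<And>b. arrow z m b \<Longrightarrow> b = i" using slice_lone_out[OF i] by blast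
    then show False by (rule lone_out_le_6[OF less.prems(3)])
  qed
qed

section \<open>From cube tilings to letterings\<close>

text \<open>
  The half-open unit intervals that start in V tile the line, so V is a translate of the integers.
\<close>

lemma unit_spaced:
  fixes V :: "real set"
  assumes cover: "\<And>r. \<exists>v\<in>V. v \<le> r \<and> r < v + 1"
    and apart: "\<And>v w. v \<in> V \<Longrightarrow> w \<in> V \<Longrightarrow> v \<le> w \<Longrightarrow> w < v + 1 \<Longrightarrow> v = w"
    and v: "v \<in> V"
  shows "w \<in> V \<longleftrightarrow> frac w = frac v"
proof -
  have up: "u + 1 \<in> V" if "u \<in> V" for u
  proof -
    obtain b where b: "b \<in> V" "b \<le> u + 1" "u + 1 < b + 1" using cover by blast
    then have "b = u + 1" using apart[OF that b(1)] by fastforce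
    then show ?thesis using b by simp
  qed
  \<comment> \<open>the interval that covers u - 1 is followed by the one that starts in u\<close>
  have down: "u - 1 \<in> V" if "u \<in> V" for u
  proof -
    obtain b where b: "b \<in> V" "b \<le> u - 1" "u - 1 < b + 1" using cover by blast
    have "b + 1 = u" using apart[OF up[OF b(1)] that] b by simp
    then show ?thesis using b by auto
  qed
  have int: "u + of_int k \<in> V" if "u \<in> V" for u k
  proof (induction k rule: int_induct[where k = 0])
    case base then show ?case using that by simp
  next
    case (step1 i) then show ?case using up[of "u + of_int i"] by (simp add: add.assoc)
  next
    case (step2 i) then show ?case using down[of "u + of_int i"] by (simp add: algebra_simps)
  qed
  show ?thesis
  proof
    assume "w \<in> V"
    have "v + of_int \<lfloor>w - v\<rfloor> = w"
      by (rule apart[OF int[OF v] \<open>w \<in> V\<close>]) linarith+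
    then show "frac w = frac v" by (metis frac_add_of_int_right)
  next
    assume "frac w = frac v"
    then have "w = v + of_int (\<lfloor>w\<rfloor> - \<lfloor>v\<rfloor>)" by (simp add: frac_def)
    then show "w \<in> V" using int[OF v] by metis
  qed
qed

text \<open>
  Interpolates between real points and layer assignments: the coordinates in S are given by the layers of z,
  the others by the point x.
\<close>

definition fits :: "'n set \<Rightarrow> ('n \<Rightarrow> real \<Rightarrow> int) \<Rightarrow> real ^ 'n \<Rightarrow> real ^ 'n \<Rightarrow> bool" where
  "fits S z x t \<longleftrightarrow> (\<forall>i\<in>S. z i (frac (t $ i)) = \<lfloor>t $ i\<rfloor>) \<and> (\<forall>i. i \<notin> S \<longrightarrow> t $ i \<le> x $ i \<and> x $ i < t $ i + 1)"

text \<open>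
  Coordinates are converted one at a time. Before coordinate i is converted, every real value of x i
  determines one cube; as x i varies, the i-th components of these cubes start unit intervals
  that tile the line. By \<open>unit_spaced\<close> they share one letter and
  assume every layer, so z i selects exactly one of them.
\<close>

lemma tiling_fits:
  fixes T :: "(real ^ 'n) set"
  assumes T: "cube_tiling T"
  shows "\<exists>!t. t \<in> T \<and> fits S z x t"
proof (induction S arbitrary: x rule: infinite_finite_induct)
  case (infinite A) then show ?case by simp
next
  case empty
  have f: "fits {} z x t \<longleftrightarrow> x \<in> cube t" for t by (simp add: fits_def mem_cube_iff)
  have "x \<in> (\<Union>t\<in>T. cube t)" using T by (simp add: cube_tiling_def)
  moreover have "s = t" if "s \<in> T" "t \<in> T" "x \<in> cube s" "x \<in> cube t" for s t
    using T that by (auto simp: cube_tiling_def)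
  ultimately show ?case unfolding f by blast
next
  case (insert i S)
  define xr where "xr r = (\<chi> j. if j = i then r else x $ j)" for r
  define V where "V = {t $ i | t r. t \<in> T \<and> fits S z (xr r) t}"
  have fr: "fits S z (xr r) t \<longleftrightarrow> t $ i \<le> r \<and> r < t $ i + 1 \<and> (\<forall>j\<in>S. z j (frac (t $ j)) = \<lfloor>t $ j\<rfloor>) \<and>
      (\<forall>j. j \<notin> S \<longrightarrow> j \<noteq> i \<longrightarrow> t $ j \<le> x $ j \<and> x $ j < t $ j + 1)" for r t
    using insert.hyps by (auto simp: fits_def xr_def)
  have fi: "fits (insert i S) z x t \<longleftrightarrow> z i (frac (t $ i)) = \<lfloor>t $ i\<rfloor> \<and> fits S z (xr (t $ i)) t" for t
    unfolding fr by (auto simp: fits_def)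
  have same: "s = t" if "s \<in> T" "t \<in> T" "fits S z (xr r) s" "fits S z (xr r) t" for s t r
    using insert.IH[of "xr r"] that by blast
  have own: "fits S z (xr (t $ i)) t" if "fits S z (xr r) t" for r t using that unfolding fr by auto
  have cover: "\<exists>v\<in>V. v \<le> r \<and> r < v + 1" for r
    using insert.IH[of "xr r"] unfolding V_def fr by blast
  have apart: "v = w" if vw: "v \<in> V" "w \<in> V" "v \<le> w" "w < v + 1" for v w
  proof -
    obtain s r where s: "v = s $ i" "s \<in> T" "fits S z (xr r) s" using vw(1) by (auto simp: V_def)
    obtain t r' where t: "w = t $ i" "t \<in> T" "fits S z (xr r') t" using vw(2) by (auto simp: V_def)
    have "fits S z (xr w) s" using s(1,3) vw unfolding fr by auto
    then have "s = t" using same[OF s(2) t(2)] own[OF t(3)] t(1) by blast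
    then show ?thesis using s t by simp
  qed
  obtain v where v: "v \<in> V" using cover by blast
  note V = unit_spaced[OF cover apart v]
  have "frac (frac v + of_int (z i (frac v))) = frac v" by (simp add: frac_def)
  then have "frac v + of_int (z i (frac v)) \<in> V" using V by blast
  then obtain t r where t: "t $ i = frac v + of_int (z i (frac v))" "t \<in> T" "fits S z (xr r) t"
    unfolding V_def by auto
  have "fits (insert i S) z x t" unfolding fi using own[OF t(3)] t(1) by (simp add: frac_def)
  moreover have "s = t" if s: "s \<in> T" "fits (insert i S) z x s" for s
  proof -
    have "s $ i \<in> V" using s unfolding fi V_def by blast
    then have "frac (s $ i) = frac v" using V by blast
    then have "s $ i = t $ i" using s t(1) unfolding fi by (simp add: frac_def)
    then show ?thesis using same[OF s(1) t(2), of "t $ i"] s(2) own[OF t(3)] unfolding fi by simp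
  qed
  ultimately show ?case using t(2) by blast
qed

lemma tiling_lettering:
  fixes T :: "(real ^ 'n) set"
  assumes T: "cube_tiling T" and nc: "\<not> contains_column T"
  shows "\<exists>L :: ('n \<Rightarrow> real \<Rightarrow> int) \<Rightarrow> 'n \<Rightarrow> real. lettering UNIV L"
proof -
  define t where "t z = (THE t. t \<in> T \<and> (\<forall>i. z i (frac (t $ i)) = \<lfloor>t $ i\<rfloor>))" for z
  have ex: "\<exists>!t. t \<in> T \<and> (\<forall>i. z i (frac (t $ i)) = \<lfloor>t $ i\<rfloor>)" for z
    using tiling_fits[OF T, of UNIV z 0] by (simp add: fits_def)
  have t: "t z \<in> T \<and> (\<forall>i. z i (frac (t z $ i)) = \<lfloor>t z $ i\<rfloor>)" for z
    unfolding t_def by (rule theI'[OF ex])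
  have t_eq: "t z = s" if "s \<in> T" "\<And>i. z i (frac (s $ i)) = \<lfloor>s $ i\<rfloor>" for z s
    using ex[of z] t[of z] that by blast
  define L where "L z i = frac (t z $ i)" for z i
  have "lettering UNIV L"
  proof
    show "L z' = L z" if "\<And>i. i \<in> UNIV \<Longrightarrow> z' i (L z i) = z i (L z i)" for z z'
    proof -
      have "t z' = t z" by (rule t_eq) (use t[of z] that in \<open>auto simp: L_def\<close>)
      then show ?thesis by (simp add: L_def fun_eq_iff)
    qed
    show "\<exists>k. L (upd z i (L z i) k) \<noteq> L z" for z i
    proof (rule ccontr)
      assume "\<not> ?thesis"
      then have col: "L (upd z i (L z i) k) = L z" for k by blast
      define s where "s = t z - of_int \<lfloor>t z $ i\<rfloor> *\<^sub>R axis i 1"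
      have "s + of_int k *\<^sub>R axis i 1 \<in> T" for k
      proof -
        define u where "u = t (upd z i (L z i) k)"
        have fr: "frac (u $ j) = frac (t z $ j)" for j using fun_cong[OF col[of k], of j] by (simp add: L_def u_def)
        have fl: "\<lfloor>u $ j\<rfloor> = (if j = i then k else \<lfloor>t z $ j\<rfloor>)" for j
          using t[of "upd z i (L z i) k"] t[of z] fr[of j] unfolding u_def[symmetric] by (metis L_def upd_eq)
        have "u $ j = (s + of_int k *\<^sub>R axis i 1) $ j" for j
          using fr[of j] fl[of j] by (auto simp: s_def axis_def frac_def)
        then have "u = s + of_int k *\<^sub>R axis i 1" by (simp add: vec_eq_iff)
        then show ?thesis using t u_def by metis
      qed
      then show False using nc contains_column_iff by blast
    qed
  qed auto
  then show ?thesis by blast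
qed

theorem theorem8:
  fixes T :: "(real ^ 6) set"
  assumes "cube_tiling T"
  shows "contains_column T"
proof (rule ccontr)
  assume "\<not> contains_column T"
  then obtain L :: "(6 \<Rightarrow> real \<Rightarrow> int) \<Rightarrow> 6 \<Rightarrow> real" where "lettering UNIV L"
    using tiling_lettering[OF assms] by blast
  then show False by (rule no_lettering_le_6) simp_all
qed

end
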